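(* Let $\mathbb{P}_R$ and $\mathbb{P}_B$ be probability distributions on the positive reals with finite means, at least one of which is non-atomic. Then, under any complete sequence of recolourings applied to the random colouring $\Delta(\mathbb{P}_R,\mathbb{P}_B)$, either (1) all points of $\mathbb{R}$ are eventually red almost surely (a red-win), or (2) all points of $\mathbb{R}$ are eventually blue almost surely (a blue-win), or (3) every point of $\mathbb{R}$ changes colour infinitely often almost surely (a tie). Furthermore, which of these three outcomes holds is independent of the choice of complete sequence of recolourings.
   Context: Colourings. A colouring of $\mathbb{R}$ into intervals is given by a doubly infinite sequence of boundary-points $(p_i)_{i\in\mathbb{Z}}$ with $p_i<p_j$ when $i<j$ and $\mathbb{R}=\bigcup_{i\in\mathbb{Z}}(p_i,p_{i+1}]$, where each $(p_{2i-1},p_{2i}]$ is coloured red and each $(p_{2i},p_{2i+1}]$ is coloured blue. It is non-degenerate if $p_k-p_j\neq p_l-p_k$ for all $j<k<l$. Recolourings. A recolouring picks a monochromatic interval (between two consecutive current boundary-points) whose two neighbouring intervals (of the opposite colour) are both strictly longer, and changes its colour, so that these three consecutive intervals subsequently form a single monochromatic interval (its two endpoints cease to be boundary-points). A sequence of recolourings (finite, or infinite and indexed by $1,2,3,\dots$), performed successively starting from an initial colouring $\Delta$, is complete if whenever at some stage there is a monochromatic interval $I$ both of whose neighbours are longer, $I$ is recoloured at that or some later step. A point is eventually red (blue) if it changes colour only finitely many times and its final colour is red (blue). Random colouring. Let $(\mathcal{R}_i)_{i\in\mathbb{Z}}$ and $(\mathcal{B}_i)_{i\in\mathbb{Z}}$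 be i.i.d. sequences, independent of each other, with distributions $\mathbb{P}_R$ and $\mathbb{P}_B$ respectively. $\Delta(\mathbb{P}_R,\mathbb{P}_B)$ is the colouring of the line into consecutive intervals $\dots,R_{-1},B_{-1},R_0,B_0,R_1,B_1,\dots$ (left to right), where $R_i$ is red of length $\mathcal{R}_i$, $B_i$ is blue of length $\mathcal{B}_i$, and the origin is the boundary-point between $R_0$ and $B_0$. A distribution is non-atomic if it has no atoms; if at least one of $\mathbb{P}_R,\mathbb{P}_B$ is non-atomic then $\Delta(\mathbb{P}_R,\mathbb{P}_B)$ is almost surely non-degenerate. *)

theory Defs
  imports "HOL-Probability.Probability"
begin

datatype colour = Red | Blue

fun opposite :: "colour \<Rightarrow> colour" where
  "opposite Red = Blue"
| "opposite Blue = Red"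

text \<open>
  A two-colouring of the line is stored as its set of current boundary-points together with
  the colour of every point, so that deleting boundary-points needs no renumbering.
\<close>

datatype colouring = Colouring (boundary: "real set") (colour_at: "real \<Rightarrow> colour")

text \<open>
  The colouring with boundary-points \<open>p\<close>: each \<open>(p (2i-1), p (2i)]\<close> is red and each
  \<open>(p (2i), p (2i+1)]\<close> is blue. It is meaningful when \<open>p\<close> is strictly increasing and unbounded
  in both directions, so that the intervals \<open>(p i, p (i+1)]\<close> partition the line.
\<close>

definition colouring_of :: "(int \<Rightarrow> real) \<Rightarrow> colouring" where
  "colouring_of p =
     Colouring (range p) (\<lambda>x. if \<exists>i. x \<in> {p (2 * i - 1)<..p (2 * i)} then Red else Blue)"

definition consecutive :: "real set \<Rightarrow> real \<Rightarrow> real \<Rightarrow> bool" where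
  "consecutive P a b \<longleftrightarrow> a \<in> P \<and> b \<in> P \<and> a < b \<and> P \<inter> {a<..<b} = {}"

text \<open>A pair \<open>(a, b)\<close> stands for the interval \<open>{a<..b}\<close>.\<close>

definition recolourable :: "colouring \<Rightarrow> real \<times> real \<Rightarrow> bool" where
  "recolourable D = (\<lambda>(a, b). \<exists>a' b'.
     consecutive (boundary D) a' a \<and> consecutive (boundary D) a b \<and> consecutive (boundary D) b b' \<and>
     b - a < a - a' \<and> b - a < b' - b)"

definition recolour :: "real \<times> real \<Rightarrow> colouring \<Rightarrow> colouring" where
  "recolour = (\<lambda>(a, b) D.
     Colouring (boundary D - {a, b})
       (\<lambda>x. if x \<in> {a<..b} then opposite (colour_at D x) else colour_at D x))"

text \<open>
  A finite or infinite sequence of intervals is a function \<open>s :: nat \<Rightarrow> (real \<times> real) option\<close>,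
  where \<open>None\<close> means that the sequence has ended; steps are numbered from \<open>0\<close>.
  \<open>stage D s n\<close> is the colouring after the first \<open>n\<close> steps (after all of them, if there are fewer).
\<close>

primrec stage :: "colouring \<Rightarrow> (nat \<Rightarrow> (real \<times> real) option) \<Rightarrow> nat \<Rightarrow> colouring" where
  "stage D s 0 = D"
| "stage D s (Suc n) =
     (case s n of None \<Rightarrow> stage D s n | Some I \<Rightarrow> recolour I (stage D s n))"

definition recolouring_sequence :: "colouring \<Rightarrow> (nat \<Rightarrow> (real \<times> real) option) \<Rightarrow> bool" where
  "recolouring_sequence D s \<longleftrightarrow>
     (\<forall>n. s n = None \<longrightarrow> s (Suc n) = None) \<and>
     (\<forall>n I. s n = Some I \<longrightarrow> recolourable (stage D s n) I)"

definition complete_recolouring :: "colouring \<Rightarrow> (nat \<Rightarrow> (real \<times> real) option) \<Rightarrow> bool" where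
  "complete_recolouring D s \<longleftrightarrow>
     recolouring_sequence D s \<and>
     (\<forall>n I. recolourable (stage D s n) I \<longrightarrow> (\<exists>m\<ge>n. s m = Some I))"

definition colour_changes ::
  "colouring \<Rightarrow> (nat \<Rightarrow> (real \<times> real) option) \<Rightarrow> real \<Rightarrow> nat set" where
  "colour_changes D s x = {n. colour_at (stage D s (Suc n)) x \<noteq> colour_at (stage D s n) x}"

definition eventually_coloured ::
  "colour \<Rightarrow> colouring \<Rightarrow> (nat \<Rightarrow> (real \<times> real) option) \<Rightarrow> real \<Rightarrow> bool" where
  "eventually_coloured c D s x \<longleftrightarrow>
     finite (colour_changes D s x) \<and> (\<forall>\<^sub>F n in sequentially. colour_at (stage D s n) x = c)"

text \<open>
  Red lengths \<open>r\<close> and blue lengths \<open>b\<close> are laid out as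
  \<open>\<dots>, r (-1), b (-1), r 0, b 0, r 1, b 1, \<dots>\<close> with the origin between \<open>r 0\<close> and \<open>b 0\<close>;
  \<open>interval_length r b j\<close> is the length of the interval that ends at the boundary-point
  with index \<open>j\<close>.
\<close>

definition interval_length :: "(int \<Rightarrow> real) \<Rightarrow> (int \<Rightarrow> real) \<Rightarrow> int \<Rightarrow> real" where
  "interval_length r b j = (if even j then r (j div 2) else b (j div 2))"

definition boundary_point :: "(int \<Rightarrow> real) \<Rightarrow> (int \<Rightarrow> real) \<Rightarrow> int \<Rightarrow> real" where
  "boundary_point r b n =
     (if n \<ge> 0 then (\<Sum>j\<in>{1..n}. interval_length r b j)
      else - (\<Sum>j\<in>{n+1..0}. interval_length r b j))"

lemma boundary_point_step:
  "boundary_point r b n - boundary_point r b (n - 1) = interval_length r b n"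
proof (cases "n \<ge> 1")
  case True
  then have "{1..n} = insert n {1..n - 1}" by auto
  with True show ?thesis by (simp add: boundary_point_def)
next
  case False
  then have "{n..0} = insert n {n + 1..0}" by auto
  with False show ?thesis by (auto simp: boundary_point_def)
qed

lemma boundary_point_0: "boundary_point r b 0 = 0"
  by (simp add: boundary_point_def)

lemma boundary_point_red: "boundary_point r b (2 * i) - boundary_point r b (2 * i - 1) = r i"
  by (simp add: boundary_point_step interval_length_def)

lemma boundary_point_blue: "boundary_point r b (2 * i + 1) - boundary_point r b (2 * i) = b i"
  using boundary_point_step[of r b "2 * i + 1"] by (simp add: interval_length_def)

text \<open>
  The random colouring, with the lengths of red and blue intervals given by the random
  variables \<open>R i\<close> and \<open>B i\<close>.
\<close>

definition iid_colouring ::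
  "(int \<Rightarrow> 'w \<Rightarrow> real) \<Rightarrow> (int \<Rightarrow> 'w \<Rightarrow> real) \<Rightarrow> 'w \<Rightarrow> colouring" where
  "iid_colouring R B \<omega> = colouring_of (boundary_point (\<lambda>i. R i \<omega>) (\<lambda>i. B i \<omega>))"

definition positive_distribution :: "real measure \<Rightarrow> bool" where
  "positive_distribution P \<longleftrightarrow> prob_space P \<and> sets P = sets borel \<and> (AE x in P. 0 < x)"

definition non_atomic :: "real measure \<Rightarrow> bool" where
  "non_atomic P \<longleftrightarrow> (\<forall>x. emeasure P {x} = 0)"

text \<open>
  In the following, \<open>S \<omega>\<close> is the sequence of recolourings applied to \<open>D \<omega>\<close>; it may depend on
  \<open>\<omega>\<close> in any way, without any measurability requirement.
\<close>

definition colour_win ::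
  "colour \<Rightarrow> 'w measure \<Rightarrow> ('w \<Rightarrow> colouring) \<Rightarrow> ('w \<Rightarrow> nat \<Rightarrow> (real \<times> real) option) \<Rightarrow> bool" where
  "colour_win c M D S \<longleftrightarrow> (AE \<omega> in M. \<forall>x. eventually_coloured c (D \<omega>) (S \<omega>) x)"

definition tie ::
  "'w measure \<Rightarrow> ('w \<Rightarrow> colouring) \<Rightarrow> ('w \<Rightarrow> nat \<Rightarrow> (real \<times> real) option) \<Rightarrow> bool" where
  "tie M D S \<longleftrightarrow> (AE \<omega> in M. \<forall>x. infinite (colour_changes (D \<omega>) (S \<omega>) x))"

end

theory Submission
  imports Defs
begin

text \<open>
  Recolouring only deletes boundary-points, so the process is followed through their indices: a state is the set \<open>S\<close> of indices of the
  boundary-points still present, and \<open>(a, b)\<close> stands for the interval from \<open>p a\<close> to \<open>p b\<close>.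

  \<^bold>\<open>Confluence.\<close> While an interval is shorter than both its neighbours, neither neighbour can be
  recoloured, and anything else that happens only lengthens them. Hence a possible recolouring stays
  possible until it is performed, and two possible recolourings commute. It follows that every
  complete sequence recolours exactly the same set \<open>removed p\<close> of intervals, each of them once. The
  number of colour changes of a point is the number of intervals in this set that cover it, so the
  fate of every point depends only on \<open>p\<close>.

  \<^bold>\<open>Three outcomes.\<close> Each index is an endpoint of at most one removed interval. So if infinitely many
  removed intervals cover one point, their endpoints tend to infinity on both sides and they cover
  every point: a tie. Otherwise, if in addition every boundary-point is eventually removed, then
  between one original interval and the next the number of covering removed intervals changes by
  exactly one, which makes up for the alternation of the original colours: all points end with the
  same colour.

  \<^bold>\<open>No boundary-point survives.\<close> A random set of integers whose law is invariant under
  translation by two is almost surely empty or unbounded on both sides, since a first or last element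
  would be a random integer with a translation-invariant law. Apply this to the set of surviving
  indices that are followed by a gap longer than \<open>q\<close>. If any boundary-point survived, then by
  non-degeneracy some of the gaps between survivors would be longer than some rational \<open>q\<close> and some would not, so a short gap would lie
  between two long ones. A shortest gap in between would then be shorter than both its neighbours and
  would have been recoloured.

  \<^bold>\<open>Ergodicity.\<close> Each outcome is an event invariant under the shift of the sequence of lengths by one
  red and one blue interval. Approximating it by an event that depends on finitely many lengths,
  which is independent of a distant translate of itself, shows that its probability is 0 or 1. As
  almost surely one of the three occurs, one of them has probability 1.
\<close>

section \<open>Removing boundary-points by index\<close>

definition adjacent :: "int set \<Rightarrow> int \<Rightarrow> int \<Rightarrow> bool" where
  "adjacent S a b \<longleftrightarrow> a \<in> S \<and> b \<in> S \<and> a < b \<and> S \<inter> {a<..<b} = {}"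

definition removable :: "(int \<Rightarrow> real) \<Rightarrow> int set \<Rightarrow> int \<times> int \<Rightarrow> bool" where
  "removable p S = (\<lambda>(a, b). \<exists>a' b'.
     adjacent S a' a \<and> adjacent S a b \<and> adjacent S b b' \<and>
     p b - p a < p a - p a' \<and> p b - p a < p b' - p b)"

abbreviation ends :: "int \<times> int \<Rightarrow> int set" where
  "ends I \<equiv> {fst I, snd I}"

fun legal :: "(int \<Rightarrow> real) \<Rightarrow> int set \<Rightarrow> (int \<times> int) list \<Rightarrow> bool" where
  "legal p S [] \<longleftrightarrow> True"
| "legal p S (I # w) \<longleftrightarrow> removable p S I \<and> legal p (S - ends I) w"

text \<open>
  The intervals that some finite sequence of recolourings performs; by confluence, these are the ones
  that every complete sequence performs.
\<close>

definition removed :: "(int \<Rightarrow> real) \<Rightarrow> (int \<times> int) set" where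
  "removed p = {I. \<exists>w. legal p UNIV w \<and> I \<in> set w}"

definition permanent :: "(int \<Rightarrow> real) \<Rightarrow> int set" where
  "permanent p = {k. \<forall>I \<in> removed p. k \<notin> ends I}"

lemma legal_append:
  "legal p S (v @ w) \<longleftrightarrow> legal p S v \<and> legal p (S - (\<Union>I\<in>set v. ends I)) w"
proof (induction v arbitrary: S)
  case (Cons I v)
  have "S - ends I - (\<Union>I\<in>set v. ends I) = S - (\<Union>J\<in>set (I # v). ends J)" by auto
  then show ?case using Cons.IH[of "S - ends I"] by simp
qed simp

lemma removable_ends: "removable p S I \<Longrightarrow> ends I \<subseteq> S \<and> fst I < snd I"
  by (auto simp: removable_def adjacent_def split: prod.splits)

lemma adjacent_no_between: "adjacent S a b \<Longrightarrow> k \<in> S \<Longrightarrow> k \<le> a \<or> b \<le> k"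
  unfolding adjacent_def disjoint_iff by (meson greaterThanLessThan_iff not_le)

lemma adjacent_ends: "adjacent S a b \<Longrightarrow> a \<in> S \<and> b \<in> S \<and> a < b"
  unfolding adjacent_def by simp

lemma adjacent_unique_right: "adjacent S a b \<Longrightarrow> adjacent S a b' \<Longrightarrow> b = b'"
  using adjacent_no_between[of S a b b'] adjacent_no_between[of S a b' b] adjacent_ends[of S a b] adjacent_ends[of S a b']
  by auto

lemma adjacent_unique_left: "adjacent S a b \<Longrightarrow> adjacent S a' b \<Longrightarrow> a = a'"
  using adjacent_no_between[of S a b a'] adjacent_no_between[of S a' b a] adjacent_ends[of S a b] adjacent_ends[of S a' b]
  by auto

lemma adjacent_less: "adjacent S a b \<Longrightarrow> adjacent S c d \<Longrightarrow> a < c \<Longrightarrow> b \<le> c"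
  using adjacent_no_between[of S a b c] adjacent_ends[of S c d] by auto

lemma adjacent_Diff: "adjacent S a b \<Longrightarrow> {a, b} \<inter> X = {} \<Longrightarrow> adjacent (S - X) a b"
  unfolding adjacent_def by auto

lemma adjacent_merge:
  assumes "adjacent S a b" "adjacent S b c" "adjacent S c d"
  shows "adjacent (S - {b, c}) a d"
proof -
  have "k \<le> a \<or> d \<le> k" if "k \<in> S - {b, c}" for k
    using that assms[THEN adjacent_no_between, of k] by auto
  then show ?thesis
    using assms[THEN adjacent_ends] unfolding adjacent_def by fastforce
qed

text \<open>
  Two intervals that are both shorter than their neighbours are not adjacent, so recolouring \<open>I\<close>
  leaves \<open>J\<close> in place. If a single interval separates them, this neighbour of \<open>J\<close> becomes part of
  a longer one; otherwise the neighbours of \<open>J\<close> do not change.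
\<close>

lemma removable_persists:
  assumes p: "strict_mono p" and I: "removable p S I" and J: "removable p S J" and "I \<noteq> J"
  shows "removable p (S - ends I) J"
proof -
  obtain a b where Iab: "I = (a, b)" by (cases I)
  obtain c d where Jcd: "J = (c, d)" by (cases J)
  from I obtain a' b' where I':
    "adjacent S a' a" "adjacent S a b" "adjacent S b b'"
    "p b - p a < p a - p a'" "p b - p a < p b' - p b"
    by (auto simp: removable_def Iab)
  from J obtain c' d' where J':
    "adjacent S c' c" "adjacent S c d" "adjacent S d d'"
    "p d - p c < p c - p c'" "p d - p c < p d' - p d"
    by (auto simp: removable_def Jcd)
  have lt: "a' < a" "a < b" "b < b'" "c' < c" "c < d" "d < d'"
    using I' J' by (auto simp: adjacent_def)
  have "a \<noteq> c"
    using adjacent_unique_right[OF I'(2)] J'(2) \<open>I \<noteq> J\<close> by (auto simp: Iab Jcd)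
  then consider "a < c" | "c < a" by linarith
  then show ?thesis
  proof cases
    case 1
    have "b \<le> c" using adjacent_less[OF I'(2) J'(2)] 1 by simp
    moreover have "b \<noteq> c"
    proof
      assume "b = c"
      then have "b' = d" "c' = a"
        using adjacent_unique_right[OF I'(3)] J'(2) adjacent_unique_left[OF J'(1)] I'(2) by auto
      then show False using I'(5) J'(4) \<open>b = c\<close> by simp
    qed
    ultimately have "b < c" by simp
    have right: "adjacent (S - {a, b}) c d" "adjacent (S - {a, b}) d d'"
      using \<open>b < c\<close> lt J' by (auto intro!: adjacent_Diff)
    show ?thesis
    proof (cases "c' = b")
      case True
      then have "b' = c" using adjacent_unique_right[OF I'(3)] J'(1) by simp
      have "p a' < p b" using lt p by (simp add: strict_mono_less)
      moreover have "adjacent (S - {a, b}) a' c"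
        using adjacent_merge I' \<open>b' = c\<close> by blast
      ultimately show ?thesis
        using right J' True by (force simp: removable_def Iab Jcd)
    next
      case False
      have "b \<le> c'" using adjacent_less[OF J'(1), of b b'] I'(3) \<open>b < c\<close> by linarith
      then have "adjacent (S - {a, b}) c' c"
        using False J'(1) lt by (auto intro!: adjacent_Diff)
      then show ?thesis
        using right J' by (force simp: removable_def Iab Jcd)
    qed
  next
    case 2
    have "d \<le> a" using adjacent_less[OF J'(2) I'(2)] 2 by simp
    moreover have "d \<noteq> a"
    proof
      assume "d = a"
      then have "d' = b" "a' = c"
        using adjacent_unique_right[OF J'(3)] I'(2) adjacent_unique_left[OF I'(1)] J'(2) by auto
      then show False using I'(4) J'(5) \<open>d = a\<close> by simp
    qed
    ultimately have "d < a" by simp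
    have left: "adjacent (S - {a, b}) c d" "adjacent (S - {a, b}) c' c"
      using \<open>d < a\<close> lt J' by (auto intro!: adjacent_Diff)
    show ?thesis
    proof (cases "d' = a")
      case True
      then have "a' = d" using adjacent_unique_left[OF I'(1)] J'(3) by simp
      have "p a < p b'" using lt p by (simp add: strict_mono_less)
      moreover have "adjacent (S - {a, b}) d b'"
        using adjacent_merge I' \<open>a' = d\<close> by blast
      ultimately show ?thesis
        using left J' True by (force simp: removable_def Iab Jcd)
    next
      case False
      have "d' \<le> a" using adjacent_less[OF J'(3) I'(2)] \<open>d < a\<close> by linarith
      then have "adjacent (S - {a, b}) d d'"
        using False J'(3) lt \<open>d < a\<close> by (auto intro!: adjacent_Diff)
      then show ?thesis
        using left J' by (force simp: removable_def Iab Jcd)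
    qed
  qed
qed

section \<open>Confluence\<close>

text \<open>
  A recolouring that is possible now can be brought to the front of any sequence: by persistence it
  stays possible, and so does every step of the sequence after it.
\<close>

lemma legal_remove1:
  assumes p: "strict_mono p"
  shows "removable p S I \<Longrightarrow> legal p S w \<Longrightarrow> legal p (S - ends I) (remove1 I w)"
proof (induction w arbitrary: S)
  case (Cons J w)
  show ?case
  proof (cases "J = I")
    case False
    then have "removable p (S - ends I) J" "removable p (S - ends J) I"
      using Cons.prems removable_persists[OF p] by auto
    moreover have "S - ends J - ends I = S - ends I - ends J" by auto
    ultimately show ?thesis
      using Cons.IH[of "S - ends J"] Cons.prems False by auto
  qed (use Cons in auto)
qed simp

text \<open>
  After \<open>v\<close>, one can still perform whatever is left of \<open>w\<close>. This is the strong form of confluence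
  from which everything about complete sequences follows.
\<close>

lemma legal_residual:
  assumes p: "strict_mono p"
  shows "legal p S v \<Longrightarrow> legal p S w \<Longrightarrow>
    legal p (S - (\<Union>I\<in>set v. ends I)) (fold remove1 v w)"
proof (induction v arbitrary: S w)
  case (Cons I v)
  have "legal p (S - ends I) (remove1 I w)" using Cons.prems legal_remove1[OF p] by simp
  then have "legal p (S - ends I - (\<Union>I\<in>set v. ends I)) (fold remove1 v (remove1 I w))"
    using Cons by simp
  moreover have "S - ends I - (\<Union>I\<in>set v. ends I) = S - (\<Union>J\<in>set (I # v). ends J)" by auto
  ultimately show ?case by simp
qed simp

lemma legal_ends_subset: "legal p S w \<Longrightarrow> I \<in> set w \<Longrightarrow> ends I \<subseteq> S \<and> fst I < snd I"
proof (induction w arbitrary: S)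
  case (Cons J w)
  then show ?case using removable_ends[of p S J] by (cases "I = J") auto
qed simp

lemma legal_disjoint_ends:
  "legal p S w \<Longrightarrow> I \<in> set w \<Longrightarrow> J \<in> set w \<Longrightarrow> ends I \<inter> ends J \<noteq> {} \<Longrightarrow> I = J"
proof (induction w arbitrary: S)
  case (Cons L w)
  have "ends L \<inter> ends I' = {}" if "I' \<in> set w" for I'
    using legal_ends_subset[of p "S - ends L" w I'] Cons.prems(1) that by auto
  then show ?case using Cons by (metis inf_commute legal.simps(2) set_ConsD)
qed simp

lemma legal_distinct: "legal p S w \<Longrightarrow> distinct w"
proof (induction w arbitrary: S)
  case (Cons L w)
  then show ?case using legal_ends_subset[of p "S - ends L" w L] by auto
qed simp

lemma set_fold_remove1:
  "distinct w \<Longrightarrow> set (fold remove1 v w) = set w - set v"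
  by (induction v arbitrary: w) auto

lemma legal_union:
  assumes p: "strict_mono p" and v: "legal p S v" and w: "legal p S w"
  shows "\<exists>u. legal p S u \<and> set u = set v \<union> set w"
proof -
  have "legal p S (v @ fold remove1 v w)"
    using legal_residual[OF p v w] v by (simp add: legal_append)
  moreover have "set (v @ fold remove1 v w) = set v \<union> set w"
    using set_fold_remove1[OF legal_distinct[OF w]] by auto
  ultimately show ?thesis by blast
qed

lemma finite_removed_legal:
  assumes p: "strict_mono p" and "finite F" "F \<subseteq> removed p"
  shows "\<exists>u. legal p UNIV u \<and> F \<subseteq> set u"
  using assms(2,3)
proof (induction F rule: finite_induct)
  case empty
  show ?case by (intro exI[of _ "[]"]) simp
next
  case (insert I F)
  then obtain u w where "legal p UNIV u" "F \<subseteq> set u" "legal p UNIV w" "I \<in> set w"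
    by (auto simp: removed_def)
  with legal_union[OF p] show ?case by (metis Un_iff insert_subset le_supI1)
qed

text \<open>
  Two removed intervals occur together in one legal sequence, and the first of them to be recoloured
  takes its endpoints away.
\<close>

lemma removed_disjoint_ends:
  assumes p: "strict_mono p" and "I \<in> removed p" "J \<in> removed p" "ends I \<inter> ends J \<noteq> {}"
  shows "I = J"
proof -
  obtain u where "legal p UNIV u" "{I, J} \<subseteq> set u"
    using finite_removed_legal[OF p, of "{I, J}"] assms by auto
  then show ?thesis using legal_disjoint_ends[of p UNIV u I J] assms(4) by simp
qed

lemma removed_less: "I \<in> removed p \<Longrightarrow> fst I < snd I"
  unfolding removed_def using legal_ends_subset[of p UNIV] by auto

section \<open>Translation of indices and surviving boundary-points\<close>

text \<open>
  Whether a recolouring is possible depends only on differences of boundary-points, which is why the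
  constant \<open>c\<close> is harmless.
\<close>

lemma legal_shift:
  "legal (\<lambda>i. p (i + d) - c) S w \<longleftrightarrow>
   legal p ((\<lambda>i. i + d) ` S) (map (\<lambda>(i, j). (i + d, j + d)) w)"
proof (induction w arbitrary: S)
  case (Cons I w)
  have adj: "adjacent ((\<lambda>i. i + d) ` S) (a + d) (b + d) \<longleftrightarrow> adjacent S a b" for a b
    unfolding adjacent_def by (auto 0 3)
  let ?S = "(\<lambda>i. i + d) ` S"
  have adj_left: "adjacent ?S a (b + d) \<longleftrightarrow> adjacent S (a - d) b" for a b
    using adj[of "a - d" b] by simp
  have adj_right: "adjacent ?S (a + d) b \<longleftrightarrow> adjacent S a (b - d)" for a b
    using adj[of a "b - d"] by simp
  have "removable (\<lambda>i. p (i + d) - c) S I \<longleftrightarrow> removable p ?S ((\<lambda>(i, j). (i + d, j + d)) I)"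
  proof (cases I)
    case (Pair a b)
    show ?thesis
    proof
      assume "removable (\<lambda>i. p (i + d) - c) S I"
      then obtain a' b' where "adjacent S a' a" "adjacent S a b" "adjacent S b b'"
          "p (b + d) - p (a + d) < p (a + d) - p (a' + d)"
          "p (b + d) - p (a + d) < p (b' + d) - p (b + d)"
        unfolding removable_def Pair by auto
      then show "removable p ?S ((\<lambda>(i, j). (i + d, j + d)) I)"
        unfolding removable_def Pair prod.case
        by - (rule exI[of _ "a' + d"], rule exI[of _ "b' + d"], simp add: adj)
    next
      assume "removable p ?S ((\<lambda>(i, j). (i + d, j + d)) I)"
      then obtain a' b' where "adjacent ?S a' (a + d)" "adjacent ?S (a + d) (b + d)"
          "adjacent ?S (b + d) b'"
          "p (b + d) - p (a + d) < p (a + d) - p a'" "p (b + d) - p (a + d) < p b' - p (b + d)"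
        unfolding removable_def Pair by auto
      then show "removable (\<lambda>i. p (i + d) - c) S I"
        unfolding removable_def Pair prod.case adj adj_left adj_right
        by - (rule exI[of _ "a' - d"], rule exI[of _ "b' - d"], simp)
    qed
  qed
  moreover have "(\<lambda>i. i + d) ` (S - ends I) = (\<lambda>i. i + d) ` S - ends ((\<lambda>(i, j). (i + d, j + d)) I)"
    by (cases I) auto
  ultimately show ?case using Cons.IH by simp
qed simp

lemma removed_shift:
  "removed (\<lambda>i. p (i + d) - c) = {(i, j). (i + d, j + d) \<in> removed p}"
proof -
  let ?f = "\<lambda>(i, j). (i + d, j + d :: int)" and ?g = "\<lambda>(i, j). (i - d, j - d :: int)"
  have *: "legal (\<lambda>i. p (i + d) - c) UNIV w \<longleftrightarrow> legal p UNIV (map ?f w)" for w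
    using legal_shift[of p d c UNIV w] by (simp add: surj_plus_right)
  show ?thesis
  proof (intro set_eqI iffI)
    fix I assume "I \<in> removed (\<lambda>i. p (i + d) - c)"
    then obtain w where "legal p UNIV (map ?f w)" "I \<in> set w" by (auto simp: removed_def *)
    then have "?f I \<in> removed p" by (auto simp: removed_def)
    then show "I \<in> {(i, j). (i + d, j + d) \<in> removed p}" by auto
  next
    fix I assume "I \<in> {(i, j). (i + d, j + d) \<in> removed p}"
    then obtain w where w: "legal p UNIV w" "?f I \<in> set w" by (auto simp: removed_def)
    have "map ?f (map ?g w) = w" by (simp add: o_def case_prod_beta)
    then have "legal p UNIV (map ?f (map ?g w))" using w(1) by (simp only:)
    moreover have "I \<in> set (map ?g w)"
      using w(2) by (auto intro!: image_eqI[of _ _ "?f I"] split: prod.splits)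
    ultimately show "I \<in> removed (\<lambda>i. p (i + d) - c)"
      unfolding removed_def * by blast
  qed
qed

lemma permanent_shift:
  "k \<in> permanent (\<lambda>i. p (i + d) - c) \<longleftrightarrow> k + d \<in> permanent p"
proof -
  have "(\<forall>I\<in>removed p. k + d \<notin> ends I) \<longleftrightarrow> (\<forall>i j. (i + d, j + d) \<in> removed p \<longrightarrow> k \<noteq> i \<and> k \<noteq> j)"
    by (auto, (metis diff_add_cancel)+)
  then show ?thesis unfolding permanent_def removed_shift by auto
qed

text \<open>
  The boundary-points strictly inside the three gaps are finitely many, so one finite sequence
  removes them all. The middle gap is then a single interval between two others, and if it were
  shorter than both it could be recoloured.
\<close>

lemma permanent_gap_no_local_min:
  assumes p: "strict_mono p"
    and adj: "adjacent (permanent p) a' a" "adjacent (permanent p) a b" "adjacent (permanent p) b b'"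
  shows "\<not> (p b - p a < p a - p a' \<and> p b - p a < p b' - p b)"
proof
  assume short: "p b - p a < p a - p a' \<and> p b - p a < p b' - p b"
  define X where "X = {a'..b'} - permanent p"
  have "\<forall>k\<in>X. \<exists>I. I \<in> removed p \<and> k \<in> ends I"
    unfolding X_def permanent_def by blast
  then obtain f where f: "\<And>k. k \<in> X \<Longrightarrow> f k \<in> removed p \<and> k \<in> ends (f k)"
    by (metis (no_types))
  have "finite X" unfolding X_def by simp
  then obtain u where u: "legal p UNIV u" "f ` X \<subseteq> set u"
    using finite_removed_legal[OF p, of "f ` X"] f by blast
  define S where "S = UNIV - (\<Union>I\<in>set u. ends I)"
  have perm: "permanent p \<subseteq> S"
    using u(1) unfolding S_def permanent_def removed_def by blast
  have S: "k \<in> S \<longleftrightarrow> k \<in> permanent p" if "a' \<le> k" "k \<le> b'" for k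
  proof
    assume "k \<in> S"
    show "k \<in> permanent p"
    proof (rule ccontr)
      assume "k \<notin> permanent p"
      then have "k \<in> X" using that by (simp add: X_def)
      then show False using f[of k] u(2) \<open>k \<in> S\<close> unfolding S_def by blast
    qed
  qed (use perm in blast)
  have "adjacent S a' a" "adjacent S a b" "adjacent S b b'"
    using adj S unfolding adjacent_def disjoint_iff by auto
  then have "removable p S (a, b)" using short by (auto simp: removable_def)
  then have "legal p UNIV (u @ [(a, b)])" using u(1) by (simp add: legal_append S_def)
  then have "(a, b) \<in> removed p"
    unfolding removed_def by (intro CollectI exI[of _ "u @ [(a, b)]"]) simp
  then show False using adj(2) unfolding adjacent_def permanent_def by fastforce
qed

section \<open>Complete sequences of recolourings\<close>

text \<open>
  Here \<open>m\<close> stands for the \<open>m\<close>-th original interval, from \<open>p (m - 1)\<close> to \<open>p m\<close>. All its points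
  have the same history.
\<close>

definition covering :: "(int \<Rightarrow> real) \<Rightarrow> int \<Rightarrow> (int \<times> int) set" where
  "covering p m = {(i, j) \<in> removed p. i < m \<and> m \<le> j}"

lemma in_covering: "I \<in> covering p m \<longleftrightarrow> I \<in> removed p \<and> fst I < m \<and> m \<le> snd I"
  by (cases I) (simp add: covering_def)

lemma consecutive_image:
  assumes p: "strict_mono p"
  shows "consecutive (p ` S) x y \<longleftrightarrow> (\<exists>i j. x = p i \<and> y = p j \<and> adjacent S i j)"
proof
  assume xy: "consecutive (p ` S) x y"
  then obtain i j where ij: "i \<in> S" "x = p i" "j \<in> S" "y = p j" by (auto simp: consecutive_def)
  have "i < j" using xy ij p by (simp add: consecutive_def strict_mono_less)
  moreover have "S \<inter> {i<..<j} = {}"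
  proof -
    have "p k \<notin> {p i<..<p j}" if "k \<in> S" for k
      using xy ij(2,4) that by (simp add: consecutive_def disjoint_iff)
    then show ?thesis using p by (auto simp: strict_mono_less)
  qed
  ultimately show "\<exists>i j. x = p i \<and> y = p j \<and> adjacent S i j"
    using ij by (auto simp: adjacent_def)
next
  assume "\<exists>i j. x = p i \<and> y = p j \<and> adjacent S i j"
  then show "consecutive (p ` S) x y"
    using p by (auto simp: consecutive_def adjacent_def disjoint_iff strict_mono_less)
qed

lemma recolourable_image:
  assumes p: "strict_mono p" and E: "boundary E = p ` S"
  shows "recolourable E I \<longleftrightarrow> (\<exists>i j. I = (p i, p j) \<and> removable p S (i, j))"
proof -
  have inj: "p i = p j \<longleftrightarrow> i = j" for i j
    using p by (simp add: strict_mono_eq)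
  show ?thesis
  proof (cases I)
    case (Pair x y)
    show ?thesis
      unfolding Pair recolourable_def removable_def E consecutive_image[OF p] prod.case
      by (auto simp: inj) blast+
  qed
qed

lemma opposite_neq [simp]: "opposite c \<noteq> c" "c \<noteq> opposite c" "opposite (opposite c) = c"
  by (cases c; simp)+

lemma not_opposite: "d \<noteq> c \<longleftrightarrow> d = opposite c"
  by (cases c; cases d; simp)

locale recolouring_process =
  fixes p :: "int \<Rightarrow> real" and s :: "nat \<Rightarrow> (real \<times> real) option"
  assumes p: "strict_mono p" and complete: "complete_recolouring (colouring_of p) s"
begin

abbreviation D :: colouring where "D \<equiv> colouring_of p"

primrec moves :: "nat \<Rightarrow> (int \<times> int) list" where
  "moves 0 = []"
| "moves (Suc n) = moves n @ (case s n of None \<Rightarrow> [] | Some (a, b) \<Rightarrow> [(inv p a, inv p b)])"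

definition remaining :: "nat \<Rightarrow> int set" where
  "remaining n = UNIV - (\<Union>I\<in>set (moves n). ends I)"

lemma inv_p [simp]: "inv p (p i) = i"
  using p by (simp add: strict_mono_imp_inj_on)

lemma p_eq_iff [simp]: "p i = p j \<longleftrightarrow> i = j"
  using p by (simp add: strict_mono_eq)

lemma step_recolourable: "s n = Some I \<Longrightarrow> recolourable (stage D s n) I"
  using complete unfolding complete_recolouring_def recolouring_sequence_def by blast

lemma stage_boundary: "boundary (stage D s n) = p ` remaining n \<and> legal p UNIV (moves n)"
proof (induction n)
  case 0
  then show ?case by (simp add: colouring_of_def remaining_def)
next
  case (Suc n)
  show ?case
  proof (cases "s n")
    case None
    then show ?thesis using Suc by (simp add: remaining_def)
  next
    case (Some I)
    have "\<exists>i j. I = (p i, p j) \<and> removable p (remaining n) (i, j)"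
      using recolourable_image[OF p, of "stage D s n" "remaining n" I] step_recolourable[OF Some] Suc
      by simp
    then obtain i j where ij: "I = (p i, p j)" "removable p (remaining n) (i, j)" by blast
    have "moves (Suc n) = moves n @ [(i, j)]" using Some ij by simp
    moreover have "p ` remaining n - {p i, p j} = p ` (remaining n - {i, j})" by auto
    ultimately show ?thesis
      using Suc ij Some by (auto simp: remaining_def legal_append recolour_def)
  qed
qed

lemma recolourable_iff:
  "recolourable (stage D s n) I \<longleftrightarrow> (\<exists>i j. I = (p i, p j) \<and> removable p (remaining n) (i, j))"
  using recolourable_image[OF p, of "stage D s n" "remaining n" I] stage_boundary by simp

lemma step_indices: "s n = Some I \<Longrightarrow> \<exists>i j. I = (p i, p j) \<and> removable p (remaining n) (i, j)"
  using step_recolourable[of n I] recolourable_iff[of n I] by simp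

lemma set_moves: "(i, j) \<in> set (moves n) \<longleftrightarrow> (\<exists>k<n. s k = Some (p i, p j))"
proof (induction n)
  case (Suc n)
  have "(i, j) \<in> set (moves (Suc n)) \<longleftrightarrow> (i, j) \<in> set (moves n) \<or> s n = Some (p i, p j)"
  proof (cases "s n")
    case (Some I)
    then obtain a b where "I = (p a, p b)" using step_indices by blast
    then show ?thesis using Some by auto
  qed simp
  then show ?case using Suc by (auto simp: less_Suc_eq)
qed simp

lemma step_unique: 
  assumes "s m = Some I" "s n = Some I"
  shows "m = n"
proof -
  have False if kl: "k < l" "s k = Some I" "s l = Some I" for k l
  proof -
    obtain i j where "I = (p i, p j)" "removable p (remaining l) (i, j)"
      using step_indices[OF kl(3)] by blast
    moreover from this have "(i, j) \<in> set (moves l)" using kl set_moves by blast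
    ultimately show False using removable_ends[of p "remaining l" "(i, j)"]
      by (force simp: remaining_def)
  qed
  then show ?thesis using assms by (meson linorder_neqE_nat)
qed

text \<open>
  If a complete sequence has performed all of a legal sequence but its last step \<open>I\<close>, then the
  residual of the sequence is \<open>I\<close> alone. So \<open>I\<close> is possible, and completeness forces it to be
  performed.
\<close>

lemma legal_performed: "legal p UNIV w \<Longrightarrow> \<exists>n. set w \<subseteq> set (moves n)"
proof (induction w rule: rev_induct)
  case (snoc I w)
  obtain n where n: "set w \<subseteq> set (moves n)" using snoc by (auto simp: legal_append)
  show ?case
  proof (cases "I \<in> set (moves n)")
    case True
    then show ?thesis using n by (intro exI[of _ n]) auto
  next
    case False
    have "distinct (w @ [I])" using legal_distinct snoc by blast
    have "fold remove1 (moves n) (w @ [I]) = [I]"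
    proof -
      have "fold remove1 v (u @ [I]) = fold remove1 v u @ [I]" if "I \<notin> set v" for u v
        using that by (induction v arbitrary: u) (auto simp: remove1_append remove1_idem)
      moreover have "set (fold remove1 (moves n) w) = {}"
        using set_fold_remove1[of w "moves n"] n \<open>distinct (w @ [I])\<close> by auto
      ultimately show ?thesis using False by simp
    qed
    then have "removable p (remaining n) I"
      using legal_residual[OF p, of UNIV "moves n" "w @ [I]"] stage_boundary[of n] snoc.prems
      by (simp add: remaining_def)
    moreover obtain i j where ij: "I = (i, j)" by (cases I)
    ultimately have "recolourable (stage D s n) (p i, p j)"
      unfolding recolourable_iff by blast
    then obtain m where m: "m \<ge> n" "s m = Some (p i, p j)"
      using complete unfolding complete_recolouring_def by blast
    have "set (moves n) \<subseteq> set (moves (Suc m))"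
    proof clarify
      fix a b assume "(a, b) \<in> set (moves n)"
      then obtain k where "k < n" "s k = Some (p a, p b)" using set_moves by blast
      then show "(a, b) \<in> set (moves (Suc m))" using m set_moves[of a b "Suc m"] by force
    qed
    moreover have "I \<in> set (moves (Suc m))" using m ij set_moves[of i j "Suc m"] by blast
    ultimately have "set (w @ [I]) \<subseteq> set (moves (Suc m))" using n by auto
    then show ?thesis by blast
  qed
qed simp

lemma removed_iff_step: "(i, j) \<in> removed p \<longleftrightarrow> (\<exists>n. s n = Some (p i, p j))"
proof
  assume "(i, j) \<in> removed p"
  then obtain w where "legal p UNIV w" "(i, j) \<in> set w" unfolding removed_def by blast
  moreover from this obtain n where "set w \<subseteq> set (moves n)" using legal_performed by blast
  ultimately have "(i, j) \<in> set (moves n)" by blast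
  then show "\<exists>n. s n = Some (p i, p j)" using set_moves by blast
next
  assume "\<exists>n. s n = Some (p i, p j)"
  then obtain n where "s n = Some (p i, p j)" ..
  then have "(i, j) \<in> set (moves (Suc n))" using set_moves by blast
  then show "(i, j) \<in> removed p" using stage_boundary[of "Suc n"] unfolding removed_def by blast
qed

lemma colour_changes_iff:
  "n \<in> colour_changes D s x \<longleftrightarrow> (\<exists>i j. s n = Some (p i, p j) \<and> p i < x \<and> x \<le> p j)"
proof (cases "s n")
  case (Some I)
  then obtain i j where "I = (p i, p j)" using step_indices by blast
  then show ?thesis using Some by (auto simp: colour_changes_def recolour_def)
qed (simp add: colour_changes_def)

lemma colour_at_stage:
  "colour_at (stage D s n) x =
   (if even (card (colour_changes D s x \<inter> {..<n})) then colour_at D x else opposite (colour_at D x))"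
proof (induction n)
  case (Suc n)
  have *: "colour_changes D s x \<inter> {..<Suc n} =
    (if n \<in> colour_changes D s x then insert n (colour_changes D s x \<inter> {..<n})
     else colour_changes D s x \<inter> {..<n})" by (auto simp: less_Suc_eq)
  show ?case
  proof (cases "n \<in> colour_changes D s x")
    case True
    then have "colour_at (stage D s (Suc n)) x = opposite (colour_at (stage D s n) x)"
      using not_opposite unfolding colour_changes_def by blast
    then show ?thesis using Suc True * by simp
  next
    case False
    then have "colour_at (stage D s (Suc n)) x = colour_at (stage D s n) x"
      unfolding colour_changes_def by blast
    then show ?thesis using Suc False * by simp
  qed
qed simp

context
  fixes x :: real and m :: int
  assumes x: "p (m - 1) < x" "x \<le> p m"
begin

lemma covers_iff: "p i < x \<and> x \<le> p j \<longleftrightarrow> i < m \<and> m \<le> j"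
proof -
  have le: "p k \<le> p l \<longleftrightarrow> k \<le> l" for k l
    using p by (simp add: strict_mono_less_eq)
  show ?thesis
    using x le[of i "m - 1"] le[of m i] le[of m j] le[of j "m - 1"] by (smt (verit))
qed

lemma initial_colour: "colour_at D x = (if even m then Red else Blue)"
proof -
  have "p (2 * i - 1) < x \<and> x \<le> p (2 * i) \<longleftrightarrow> m = 2 * i" for i
    using covers_iff[of "2 * i - 1" "2 * i"] by auto
  then show ?thesis by (auto simp: colouring_of_def)
qed

text \<open>
  A point changes colour exactly when a step recolours an interval around it, and different steps
  recolour different intervals.
\<close>

lemma bij_betw_colour_changes: "\<exists>f. bij_betw f (colour_changes D s x) (covering p m)"
proof -
  define f where "f n = (inv p (fst (the (s n))), inv p (snd (the (s n))))" for n
  have f: "f n = (i, j)" if "s n = Some (p i, p j)" for n i j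
    using that by (simp add: f_def)
  have "bij_betw f (colour_changes D s x) (covering p m)"
  proof (rule bij_betwI')
    fix k l assume "k \<in> colour_changes D s x" "l \<in> colour_changes D s x"
    then obtain a b c d where "s k = Some (p a, p b)" "s l = Some (p c, p d)"
      unfolding colour_changes_iff by blast
    then show "f k = f l \<longleftrightarrow> k = l" using f step_unique by auto
  next
    fix k assume "k \<in> colour_changes D s x"
    then obtain i j where "s k = Some (p i, p j)" "p i < x \<and> x \<le> p j"
      unfolding colour_changes_iff by blast
    then show "f k \<in> covering p m"
      using f covers_iff removed_iff_step by (auto simp: covering_def)
  next
    fix I assume "I \<in> covering p m"
    then obtain i j where ij: "I = (i, j)" "(i, j) \<in> removed p" "i < m \<and> m \<le> j"
      by (auto simp: covering_def)
    then obtain n where n: "s n = Some (p i, p j)" using removed_iff_step by blast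
    then have "n \<in> colour_changes D s x" unfolding colour_changes_iff using covers_iff ij by blast
    then show "\<exists>n\<in>colour_changes D s x. I = f n" using f[OF n] ij(1) by (intro bexI[of _ n]) simp_all
  qed
  then show ?thesis by blast
qed

lemma infinite_colour_changes_iff: "infinite (colour_changes D s x) \<longleftrightarrow> infinite (covering p m)"
  using bij_betw_colour_changes bij_betw_finite by blast

lemma eventually_coloured_iff:
  "eventually_coloured c D s x \<longleftrightarrow>
   finite (covering p m) \<and> (even m = even (card (covering p m)) \<longleftrightarrow> c = Red)"
proof (cases "finite (covering p m)")
  case True
  let ?C = "colour_changes D s x"
  have fin: "finite ?C" using True infinite_colour_changes_iff by blast
  have card: "card ?C = card (covering p m)"
    using bij_betw_colour_changes bij_betw_same_card by blast
  obtain N where N: "?C \<subseteq> {..<N}" using fin finite_nat_bounded by blast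
  let ?d = "if even (card ?C) then colour_at D x else opposite (colour_at D x)"
  have "colour_at (stage D s n) x = ?d" if "n \<ge> N" for n
  proof -
    have "?C \<inter> {..<n} = ?C" using N that by auto
    then show ?thesis using colour_at_stage[of n x] by simp
  qed
  then have ev: "\<forall>\<^sub>F n in sequentially. colour_at (stage D s n) x = ?d"
    using eventually_sequentially by blast
  have "(\<forall>\<^sub>F n in sequentially. colour_at (stage D s n) x = c) \<longleftrightarrow> c = ?d"
  proof
    assume "\<forall>\<^sub>F n in sequentially. colour_at (stage D s n) x = c"
    with ev have "\<forall>\<^sub>F n in sequentially. c = ?d" by eventually_elim simp
    then show "c = ?d" by simp
  qed (use ev in simp)
  also have "\<dots> \<longleftrightarrow> (even m = even (card (covering p m)) \<longleftrightarrow> c = Red)"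
    unfolding card initial_colour by (cases c) auto
  finally show ?thesis using fin True by (simp add: eventually_coloured_def)
next
  case False
  then show ?thesis using infinite_colour_changes_iff by (simp add: eventually_coloured_def)
qed

end

end

section \<open>The three outcomes\<close>

text \<open>
  This form of a tie mentions neither a point nor a sequence of recolourings, which makes its
  measurability and its invariance under translation evident.
\<close>

definition covers_everything :: "(int \<Rightarrow> real) \<Rightarrow> bool" where
  "covers_everything p \<longleftrightarrow> (\<forall>n\<ge>0. \<exists>(i, j) \<in> removed p. i \<le> - n \<and> n \<le> j)"

text \<open>
  The \<open>m\<close>-th original interval is red for even \<open>m\<close> and blue for odd \<open>m\<close>, and it changes colour
  \<open>card (covering p m)\<close> times; so the equality of parities says that it ends up red.
\<close>

definition final_colour :: "colour \<Rightarrow> (int \<Rightarrow> real) \<Rightarrow> bool" where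
  "final_colour c p \<longleftrightarrow> (\<forall>m. finite (covering p m) \<and> (even m = even (card (covering p m)) \<longleftrightarrow> c = Red))"

text \<open>
  Since removed intervals do not share endpoints, only finitely many of those covering \<open>m\<close> have an
  endpoint within a bounded distance; hence infinitely many of them reach beyond any bound on both
  sides.
\<close>

lemma infinite_covering_iff:
  assumes p: "strict_mono p"
  shows "infinite (covering p m) \<longleftrightarrow> covers_everything p"
proof
  assume inf: "infinite (covering p m)"
  show "covers_everything p" unfolding covers_everything_def
  proof (intro allI impI)
    fix n :: int assume "0 \<le> n"
    have unique: "I = J" if "I \<in> covering p m" "J \<in> covering p m" "fst I = fst J \<or> snd I = snd J" for I J
      using that removed_disjoint_ends[OF p, of I J] by (auto simp: covering_def)
    have "inj_on fst {I \<in> covering p m. fst I \<in> {- n<..<m}}"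
      by (rule inj_onI, rule unique) simp_all
    moreover have "finite (fst ` {I \<in> covering p m. fst I \<in> {- n<..<m}})"
      by (rule finite_subset[of _ "{-n<..<m}"]) auto
    ultimately have fin1: "finite {I \<in> covering p m. fst I \<in> {- n<..<m}}"
      using finite_imageD by blast
    have fin2: "finite {I \<in> covering p m. snd I \<in> {m..<n}}"
    proof -
      have "inj_on snd {I \<in> covering p m. snd I \<in> {m..<n}}"
        by (rule inj_onI, rule unique) simp_all
      moreover have "finite (snd ` {I \<in> covering p m. snd I \<in> {m..<n}})"
        by (rule finite_subset[of _ "{m..<n}"]) auto
      ultimately show ?thesis using finite_imageD by blast
    qed
    have "\<not> covering p m \<subseteq> {I \<in> covering p m. fst I \<in> {- n<..<m}} \<union> {I \<in> covering p m. snd I \<in> {m..<n}}"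
      using inf fin1 fin2 by (meson finite_UnI finite_subset)
    then obtain I where "I \<in> covering p m" "fst I \<notin> {- n<..<m}" "snd I \<notin> {m..<n}"
      by blast
    then show "\<exists>(i, j) \<in> removed p. i \<le> - n \<and> n \<le> j"
      unfolding covering_def by (intro bexI[of _ I]) (auto split: prod.splits)
  qed
next
  assume cov: "covers_everything p"
  show "infinite (covering p m)"
  proof
    assume fin: "finite (covering p m)"
    \<comment> \<open>Beyond all the right endpoints, and beyond \<open>m\<close> so that the interval found covers \<open>m\<close>.\<close>
    define n where "n = Max (insert (\<bar>m\<bar>) (snd ` covering p m)) + 1"
    have bound: "k < n" if "k \<in> insert \<bar>m\<bar> (snd ` covering p m)" for k
      using Max_ge[of "insert \<bar>m\<bar> (snd ` covering p m)" k] fin that unfolding n_def by simp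
    have "\<bar>m\<bar> < n" using bound by simp
    then have "0 \<le> n" by simp
    then obtain I where I: "I \<in> removed p" "fst I \<le> - n" "n \<le> snd I"
      using cov unfolding covers_everything_def by (auto split: prod.splits)
    then have "I \<in> covering p m"
      using \<open>\<bar>m\<bar> < n\<close> by (auto simp: covering_def split: prod.splits)
    then have "snd I < n" using bound by simp
    then show False using I by simp
  qed
qed

text \<open>
  Exactly one removed interval has \<open>m\<close> as an endpoint, and it is the only one to tell the two sides of \<open>m\<close>
  apart.
\<close>

lemma parity_card_covering_Suc:
  assumes p: "strict_mono p" and K: "permanent p = {}" and fin: "\<And>m. finite (covering p m)"
  shows "even (card (covering p (m + 1))) \<longleftrightarrow> odd (card (covering p m))"
proof -
  obtain I where I: "I \<in> removed p" "m \<in> ends I" using K unfolding permanent_def by blast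
  have other: "J \<in> covering p (m + 1) \<longleftrightarrow> J \<in> covering p m" if "J \<noteq> I" for J
  proof (cases "J \<in> removed p")
    case True
    have "m \<notin> ends J" using removed_disjoint_ends[OF p True I(1)] that I by blast
    then show ?thesis using True by (auto simp: in_covering)
  qed (simp add: in_covering)
  have less: "fst I < snd I" using removed_less I by blast
  show ?thesis
  proof (cases "m = fst I")
    case True
    then have "I \<notin> covering p m" "I \<in> covering p (m + 1)"
      using less I by (simp_all add: in_covering)
    then have "J \<in> covering p (m + 1) \<longleftrightarrow> J \<in> insert I (covering p m)" for J
      using other[of J] by (cases "J = I") simp_all
    then have "covering p (m + 1) = insert I (covering p m)" by (rule set_eqI)
    then show ?thesis using \<open>I \<notin> covering p m\<close> fin[of m] by simp
  next
    case False
    then have "I \<notin> covering p (m + 1)" "I \<in> covering p m"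
      using less I by (auto simp: in_covering)
    then have "J \<in> covering p m \<longleftrightarrow> J \<in> insert I (covering p (m + 1))" for J
      using other[of J] by (cases "J = I") simp_all
    then have "covering p m = insert I (covering p (m + 1))" by (rule set_eqI)
    then show ?thesis using \<open>I \<notin> covering p (m + 1)\<close> fin[of "m + 1"] by simp
  qed
qed

lemma trichotomy:
  assumes p: "strict_mono p" and K: "permanent p = {}"
  shows "final_colour Red p \<or> final_colour Blue p \<or> covers_everything p"
proof (cases "covers_everything p")
  case False
  then have fin: "finite (covering p m)" for m using infinite_covering_iff[OF p] by blast
  have step: "even (m + 1) = even (card (covering p (m + 1))) \<longleftrightarrow> even m = even (card (covering p m))" for m
    using parity_card_covering_Suc[OF p K fin] by auto
  have "even m = even (card (covering p m)) \<longleftrightarrow> even (card (covering p 0))" for m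
  proof (induction m rule: int_induct[of _ 0])
    case (step1 i)
    then show ?case using step[of i] by simp
  next
    case (step2 i)
    then show ?case using step[of "i - 1"] by simp
  qed simp
  then show ?thesis using fin unfolding final_colour_def by (cases "even (card (covering p 0))") auto
qed simp

lemma covers_everything_shift:
  "covers_everything (\<lambda>i. p (i + d) - c) \<longleftrightarrow> covers_everything p"
proof -
  have *: "covers_everything (\<lambda>i. q (i + d) - c)" if q: "covers_everything q" for q c d
    unfolding covers_everything_def
  proof (intro allI impI)
    fix n :: int assume "0 \<le> n"
    then have "0 \<le> n + \<bar>d\<bar>" by simp
    then obtain i j where "(i, j) \<in> removed q" "i \<le> - (n + \<bar>d\<bar>)" "n + \<bar>d\<bar> \<le> j"
      using q unfolding covers_everything_def by blast
    then show "\<exists>(i, j)\<in>removed (\<lambda>i. q (i + d) - c). i \<le> - n \<and> n \<le> j"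
      unfolding removed_shift by (intro bexI[of _ "(i - d, j - d)"]) auto
  qed
  show ?thesis using *[of p d c] *[of "\<lambda>i. p (i + d) - c" "- d" "- c"] by auto
qed

lemma final_colour_shift:
  assumes "even d"
  shows "final_colour k (\<lambda>i. p (i + d) - c) \<longleftrightarrow> final_colour k p"
proof -
  have cov: "bij_betw (\<lambda>(i, j). (i + d, j + d)) (covering (\<lambda>i. p (i + d) - c) m) (covering p (m + d))" for m
    by (rule bij_betwI[of _ _ _ "\<lambda>(i, j). (i - d, j - d)"]) (auto simp: covering_def removed_shift)
  have "final_colour k (\<lambda>i. p (i + d) - c) \<longleftrightarrow>
    (\<forall>m. finite (covering p (m + d)) \<and> (even (m + d) = even (card (covering p (m + d))) \<longleftrightarrow> k = Red))"
    unfolding final_colour_def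
    using bij_betw_finite[OF cov] bij_betw_same_card[OF cov] assms by simp
  also have "\<dots> \<longleftrightarrow> final_colour k p"
    unfolding final_colour_def by (metis diff_add_cancel)
  finally show ?thesis .
qed

section \<open>Gaps between surviving boundary-points\<close>

lemma adjacent_next:
  assumes "k \<in> S" "l \<in> S" "k < l"
  shows "\<exists>k'. adjacent S k k' \<and> k' \<le> l"
proof -
  let ?X = "S \<inter> {k<..l}"
  have fin: "finite ?X" "?X \<noteq> {}" using assms by auto
  have "adjacent S k (Min ?X)"
    unfolding adjacent_def disjoint_iff
  proof (intro conjI allI impI)
    show "Min ?X \<in> S" "k < Min ?X" using Min_in[OF fin] by auto
    fix i assume "i \<in> S"
    show "i \<notin> {k<..<Min ?X}"
    proof
      assume i: "i \<in> {k<..<Min ?X}"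
      have "Min ?X \<le> l" using Min_in[OF fin] by auto
      then have "i \<in> ?X" using i \<open>i \<in> S\<close> by auto
      then show False using Min_le[OF fin(1)] i by fastforce
    qed
  qed (use assms in simp)
  moreover have "Min ?X \<le> l" using Min_in[OF fin] by auto
  ultimately show ?thesis by blast
qed

lemma adjacent_prev:
  assumes "k \<in> S" "l \<in> S" "k < l"
  shows "\<exists>l'. adjacent S l' l \<and> k \<le> l'"
proof -
  let ?X = "S \<inter> {k..<l}"
  have fin: "finite ?X" "?X \<noteq> {}" using assms by auto
  have "adjacent S (Max ?X) l"
    unfolding adjacent_def disjoint_iff
  proof (intro conjI allI impI)
    show "Max ?X \<in> S" "Max ?X < l" using Max_in[OF fin] by auto
    fix i assume "i \<in> S"
    show "i \<notin> {Max ?X<..<l}"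
    proof
      assume i: "i \<in> {Max ?X<..<l}"
      have "k \<le> Max ?X" using Max_in[OF fin] by auto
      then have "i \<in> ?X" using i \<open>i \<in> S\<close> by auto
      then show False using Max_ge[OF fin(1)] i by fastforce
    qed
  qed (use assms in simp)
  moreover have "k \<le> Max ?X" using Max_in[OF fin] by auto
  ultimately show ?thesis by blast
qed

definition nondegenerate :: "(int \<Rightarrow> real) \<Rightarrow> bool" where
  "nondegenerate p \<longleftrightarrow> (\<forall>j k l. j < k \<longrightarrow> k < l \<longrightarrow> p k - p j \<noteq> p l - p k)"

definition long_gaps :: "real \<Rightarrow> (int \<Rightarrow> real) \<Rightarrow> int set" where
  "long_gaps q p = {k. \<exists>k'. adjacent (permanent p) k k' \<and> q < p k' - p k}"

definition short_gaps :: "real \<Rightarrow> (int \<Rightarrow> real) \<Rightarrow> int set" where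
  "short_gaps q p = {k. \<exists>k'. adjacent (permanent p) k k' \<and> p k' - p k \<le> q}"

text \<open>
  Among the finitely many gaps from \<open>u\<close> to \<open>u'\<close>, a shortest one is short, hence not the first or
  the last, and non-degeneracy makes it strictly shorter than its two neighbours.
\<close>

lemma no_short_gap_between_long_gaps:
  assumes p: "strict_mono p" and nd: "nondegenerate p"
    and u: "u \<in> long_gaps q p" and v: "v \<in> short_gaps q p" and u': "u' \<in> long_gaps q p"
    and "u \<le> v" "v \<le> u'"
  shows False
proof -
  let ?K = "permanent p"
  define C where "C = ?K \<inter> {u..u'}"
  define nxt where "nxt k = (SOME k'. adjacent ?K k k')" for k
  have nxt_eq: "nxt k = k'" if "adjacent ?K k k'" for k k'
    unfolding nxt_def using that adjacent_unique_right by blast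
  define gap where "gap k = p (nxt k) - p k" for k
  have long: "q < gap k \<and> adjacent ?K k (nxt k)" if "k \<in> long_gaps q p" for k
    using that nxt_eq by (auto simp: long_gaps_def gap_def)
  have short: "gap k \<le> q \<and> adjacent ?K k (nxt k)" if "k \<in> short_gaps q p" for k
    using that nxt_eq by (auto simp: short_gaps_def gap_def)
  have "v \<in> C" using adjacent_ends[of ?K v "nxt v"] short[OF v] assms by (simp add: C_def)
  have uK: "u \<in> ?K" "u' \<in> ?K"
    using adjacent_ends[of ?K u "nxt u"] adjacent_ends[of ?K u' "nxt u'"] long u u' by auto
  have "finite C" by (simp add: C_def)
  then obtain m where m: "m \<in> C" "\<And>k. k \<in> C \<Longrightarrow> gap m \<le> gap k"
    using \<open>v \<in> C\<close> ex_min_if_finite[of "gap ` C"]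
    by (metis (mono_tags, lifting) arg_min_if_finite(1) arg_min_least empty_iff)
  have "gap m \<le> q" using m(2)[OF \<open>v \<in> C\<close>] short[OF v] by linarith
  then have "m \<noteq> u" "m \<noteq> u'" using long u u' by force+
  then have mK: "m \<in> ?K" "u < m" "m < u'" using m(1) by (auto simp: C_def)
  obtain b where b: "adjacent ?K m b" "b \<le> u'" using adjacent_next[OF mK(1) uK(2) mK(3)] by blast
  obtain a where a: "adjacent ?K a m" "u \<le> a" using adjacent_prev[OF uK(1) mK(1) mK(2)] by blast
  have "\<exists>b'. adjacent ?K b b'"
  proof (cases "b = u'")
    case True
    then show ?thesis using long[OF u'] by blast
  next
    case False
    then show ?thesis using adjacent_next[of b ?K u'] b adjacent_ends[OF b(1)] uK by auto
  qed
  then obtain b' where b': "adjacent ?K b b'" by blast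
  have in_C: "a \<in> C" "b \<in> C"
    using a b adjacent_ends[OF a(1)] adjacent_ends[OF b(1)] mK by (auto simp: C_def)
  have gaps: "gap a = p m - p a" "gap m = p b - p m" "gap b = p b' - p b"
    using nxt_eq a b b' by (simp_all add: gap_def)
  have lt: "a < m" "m < b" "b < b'" using adjacent_ends a(1) b(1) b' by blast+
  have "gap m \<noteq> gap a" "gap m \<noteq> gap b"
    using nd lt unfolding nondegenerate_def gaps by metis+
  then have "gap m < gap a" "gap m < gap b" using m(2) in_C by fastforce+
  then show False
    using permanent_gap_no_local_min[OF p a(1) b(1) b'] unfolding gaps by blast
qed

text \<open>
  Consecutive gaps have different lengths, so a rational number separates them.
\<close>

lemma exists_long_and_short_gap:
  assumes nd: "nondegenerate p"
    and K: "permanent p \<noteq> {}" and unbounded: "\<And>n. \<exists>k\<in>permanent p. n \<le> k"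
  shows "\<exists>q\<in>\<rat>. long_gaps q p \<noteq> {} \<and> short_gaps q p \<noteq> {}"
proof -
  have next_ex: "\<exists>k'. adjacent (permanent p) k k'" if "k \<in> permanent p" for k
  proof -
    obtain l where "l \<in> permanent p" "k + 1 \<le> l" using unbounded by blast
    then show ?thesis using adjacent_next[of k "permanent p" l] that by auto
  qed
  obtain a where "a \<in> permanent p" using K by blast
  then obtain b where b: "adjacent (permanent p) a b" using next_ex by blast
  then obtain c where c: "adjacent (permanent p) b c" using next_ex adjacent_ends by blast
  have "p b - p a \<noteq> p c - p b"
    using nd adjacent_ends[OF b] adjacent_ends[OF c] unfolding nondegenerate_def by blast
  then consider "p b - p a < p c - p b" | "p c - p b < p b - p a" by linarith
  then show ?thesis
  proof cases
    case 1
    then obtain q where "q \<in> \<rat>" "p b - p a < q" "q < p c - p b" using Rats_dense_in_real by blast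
    then have "a \<in> short_gaps q p" "b \<in> long_gaps q p"
      using b c unfolding short_gaps_def long_gaps_def by auto
    then show ?thesis using \<open>q \<in> \<rat>\<close> by blast
  next
    case 2
    then obtain q where "q \<in> \<rat>" "p c - p b < q" "q < p b - p a" using Rats_dense_in_real by blast
    then have "b \<in> short_gaps q p" "a \<in> long_gaps q p"
      using b c unfolding short_gaps_def long_gaps_def by auto
    then show ?thesis using \<open>q \<in> \<rat>\<close> by blast
  qed
qed

lemma adjacent_shift: "adjacent {k. k + d \<in> S} a b \<longleftrightarrow> adjacent S (a + d) (b + d)"
proof -
  have "(\<forall>k. k + d \<in> S \<longrightarrow> \<not> (a < k \<and> k < b)) \<longleftrightarrow> (\<forall>k. k \<in> S \<longrightarrow> \<not> (a + d < k \<and> k < b + d))"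
    by (metis add_less_cancel_right diff_add_cancel)
  then show ?thesis unfolding adjacent_def disjoint_iff by auto
qed

lemma permanent_shift_eq: "permanent (\<lambda>i. p (i + d) - c) = {k. k + d \<in> permanent p}"
  using permanent_shift by blast

lemma ex_int_shift: "(\<exists>k. Q (k + d)) \<longleftrightarrow> (\<exists>k::int. Q k)"
  by (metis diff_add_cancel)

lemma long_gaps_shift: "k \<in> long_gaps q (\<lambda>i. p (i + d) - c) \<longleftrightarrow> k + d \<in> long_gaps q p"
  using ex_int_shift[of "\<lambda>k'. adjacent (permanent p) (k + d) k' \<and> q < p k' - p (k + d)" d]
  by (simp add: long_gaps_def permanent_shift_eq adjacent_shift)

section \<open>Boundary-points as sums of lengths\<close>

text \<open>
  The boundary-points obtained by laying out intervals of lengths \<open>x\<close>, where \<open>x j\<close> is the length of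
  the interval ending at index \<open>j\<close>. Merging the red and blue lengths into one sequence turns the
  translation of the colouring into a shift of \<open>x\<close>.
\<close>

definition gap_sum :: "(int \<Rightarrow> real) \<Rightarrow> int \<Rightarrow> real" where
  "gap_sum x n = (if n \<ge> 0 then (\<Sum>j\<in>{1..n}. x j) else - (\<Sum>j\<in>{n+1..0}. x j))"

lemma boundary_point_eq_gap_sum: "boundary_point r b = gap_sum (interval_length r b)"
  by (rule ext) (simp add: boundary_point_def gap_sum_def)

lemma gap_sum_diff:
  assumes "a \<le> b"
  shows "gap_sum x b - gap_sum x a = (\<Sum>j\<in>{a+1..b}. x j)"
proof -
  consider "0 \<le> a" | "a < 0" "0 \<le> b" | "b < 0" by linarith
  then show ?thesis
  proof cases
    case 1
    then have "{1..b} = {1..a} \<union> {a+1..b}" using assms by auto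
    then have "sum x {1..b} = sum x {1..a} + sum x {a+1..b}"
      by (simp add: sum.union_disjoint)
    then show ?thesis using 1 assms by (simp add: gap_sum_def)
  next
    case 2
    then have "{a+1..b} = {a+1..0} \<union> {1..b}" by auto
    then have "sum x {a+1..b} = sum x {a+1..0} + sum x {1..b}"
      by (simp add: sum.union_disjoint)
    then show ?thesis using 2 by (simp add: gap_sum_def)
  next
    case 3
    then have "{a+1..0} = {a+1..b} \<union> {b+1..0}" using assms by auto
    then have "sum x {a+1..0} = sum x {a+1..b} + sum x {b+1..0}"
      by (simp add: sum.union_disjoint)
    then show ?thesis using 3 assms by (simp add: gap_sum_def)
  qed
qed

lemma gap_sum_step: "gap_sum x n = gap_sum x (n - 1) + x n"
  using gap_sum_diff[of "n - 1" n x] by simp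

lemma strict_mono_gap_sum:
  assumes "\<And>j. 0 < x j"
  shows "strict_mono (gap_sum x)"
proof (rule strict_monoI)
  fix a b :: int assume "a < b"
  then have "0 < (\<Sum>j\<in>{a+1..b}. x j)" using assms by (intro sum_pos) auto
  then show "gap_sum x a < gap_sum x b" using gap_sum_diff[of a b x] \<open>a < b\<close> by simp
qed

text \<open>
  The shift is by two, since only even translations preserve the colours.
\<close>

definition shift :: "(int \<Rightarrow> 'a) \<Rightarrow> int \<Rightarrow> 'a" where
  "shift x = (\<lambda>j. x (j + 2))"

lemma gap_sum_shift: "gap_sum (shift x) = (\<lambda>i. gap_sum x (i + 2) - gap_sum x 2)"
proof
  fix i
  have *: "gap_sum (shift x) b - gap_sum (shift x) a = gap_sum x (b + 2) - gap_sum x (a + 2)"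
    if "a \<le> b" for a b
  proof -
    have "(\<Sum>j\<in>{a+1..b}. x (j + 2)) = (\<Sum>j\<in>{a+2+1..b+2}. x j)"
      by (rule sum.reindex_bij_witness[of _ "\<lambda>j. j - 2" "\<lambda>j. j + 2"]) auto
    then show ?thesis using that by (simp add: gap_sum_diff shift_def)
  qed
  have "gap_sum (shift x) 0 = 0" by (simp add: gap_sum_def)
  then show "gap_sum (shift x) i = gap_sum x (i + 2) - gap_sum x 2"
    using *[of 0 i] *[of i 0] by (cases "0 \<le> i") auto
qed

definition exhausts_line :: "(int \<Rightarrow> real) \<Rightarrow> bool" where
  "exhausts_line p \<longleftrightarrow> (\<forall>y. \<exists>m. p (m - 1) < y \<and> y \<le> p m)"

definition regular :: "(int \<Rightarrow> real) \<Rightarrow> bool" where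
  "regular p \<longleftrightarrow> strict_mono p \<and> exhausts_line p \<and> permanent p = {}"

lemma exhausts_line_gap_sum:
  assumes pos: "\<And>j. 0 < x j" and e: "0 < e"
    and right: "\<And>n. \<exists>i\<ge>n. e < x i" and left: "\<And>n. \<exists>i\<le>n. e < x i"
  shows "exhausts_line (gap_sum x)"
proof -
  let ?p = "gap_sum x"
  have mono: "?p a \<le> ?p b" if "a \<le> b" for a b
    using strict_mono_gap_sum[OF pos] that by (simp add: strict_mono_less_eq)
  have up: "\<exists>m. real k * e \<le> ?p m" for k
  proof (induction k)
    case 0
    show ?case by (intro exI[of _ 0]) (simp add: gap_sum_def)
  next
    case (Suc k)
    then obtain m where m: "real k * e \<le> ?p m" by blast
    obtain i where i: "m + 1 \<le> i" "e < x i" using right by blast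
    have "real (Suc k) * e \<le> ?p i"
      using m i gap_sum_step[of x i] mono[of m "i - 1"] by (simp add: algebra_simps)
    then show ?case by blast
  qed
  have down: "\<exists>m. ?p m \<le> - (real k * e)" for k
  proof (induction k)
    case 0
    show ?case by (intro exI[of _ 0]) (simp add: gap_sum_def)
  next
    case (Suc k)
    then obtain m where m: "?p m \<le> - (real k * e)" by blast
    obtain i where i: "i \<le> m" "e < x i" using left by blast
    have "?p (i - 1) \<le> - (real (Suc k) * e)"
      using m i gap_sum_step[of x i] mono[of i m] by (simp add: algebra_simps)
    then show ?case by blast
  qed
  show ?thesis unfolding exhausts_line_def
  proof
    fix y :: real
    obtain k where "\<bar>y\<bar> < real k * e" using ex_less_of_nat_mult[OF e] by blast
    moreover obtain a where "?p a \<le> - (real k * e)" using down by blast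
    moreover obtain b where "real k * e \<le> ?p b" using up by blast
    ultimately have ab: "?p a < y" "y \<le> ?p b" by auto
    have "a < b" using ab mono[of b a] by linarith
    let ?X = "{i\<in>{a..b}. y \<le> ?p i}"
    have "b \<in> ?X" using ab \<open>a < b\<close> by simp
    moreover have "finite ?X" by (rule finite_subset[of _ "{a..b}"]) auto
    ultimately have fin: "finite ?X" "?X \<noteq> {}" by blast+
    define m where "m = Min ?X"
    have m: "m \<in> ?X" unfolding m_def by (rule Min_in[OF fin])
    have "?p (m - 1) < y"
    proof (rule ccontr)
      assume "\<not> ?p (m - 1) < y"
      moreover have "m \<noteq> a" using m ab by auto
      ultimately have "m - 1 \<in> ?X" using m by auto
      then show False using Min_le[OF fin(1)] unfolding m_def by fastforce
    qed
    then show "\<exists>m. ?p (m - 1) < y \<and> y \<le> ?p m" using m by blast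
  qed
qed

section \<open>Stationary random sets of indices\<close>

locale periodic_product =
  fixes P :: "int \<Rightarrow> real measure"
  assumes prob_marginal: "\<And>j. prob_space (P j)"
    and sets_marginal [measurable_cong]: "\<And>j. sets (P j) = sets borel"
    and periodic: "\<And>j. P (j + 2) = P j"
begin

sublocale product_prob_space P UNIV
  by (rule product_prob_spaceI) (rule prob_marginal)

abbreviation N :: "(int \<Rightarrow> real) measure" where
  "N \<equiv> PiM UNIV P"

lemma space_marginal [simp]: "space (P j) = UNIV"
  using sets_eq_imp_space_eq[OF sets_marginal] by simp

lemma space_N [simp]: "space N = UNIV"
  by (simp add: space_PiM)

lemma coordinate_measurable [measurable]: "(\<lambda>x. x j) \<in> borel_measurable N"
  using measurable_component_singleton[of j UNIV P] by (simp cong: measurable_cong_sets add: sets_marginal)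

lemma shift_measurable [measurable]: "shift \<in> measurable N N"
proof -
  have "(\<lambda>x. x (j + 2)) \<in> measurable N (P j)" for j
    using measurable_component_singleton[of "j + 2" UNIV P] by (simp add: periodic)
  then have "(\<lambda>x. \<lambda>j\<in>UNIV. x (j + 2)) \<in> measurable N N"
    by (intro measurable_restrict)
  then show ?thesis by (simp add: shift_def[abs_def] restrict_UNIV)
qed

lemma distr_shift: "distr N N shift = N"
  using distr_PiM_reindex[of UNIV P "\<lambda>j. j + 2" UNIV] prob_marginal
  by (simp add: periodic shift_def[abs_def] inj_def restrict_UNIV)

lemma prob_shift: "A \<in> sets N \<Longrightarrow> prob (shift -` A) = prob A"
  using measure_distr[OF shift_measurable, of A] by (simp add: distr_shift)

text \<open>
  Events \<open>E m\<close> of the form ``the distinguished index is \<open>m\<close>'' are disjoint and, along indices of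
  equal parity, equally likely; infinitely many of them fit into a probability space only if they
  have probability zero.
\<close>

lemma equivariant_disjoint_null:
  fixes E :: "int \<Rightarrow> (int \<Rightarrow> real) set"
  assumes E: "\<And>m. E m \<in> sets N" and equi: "\<And>m. shift -` E m = E (m + 2)"
    and disj: "\<And>m n. m \<noteq> n \<Longrightarrow> E m \<inter> E n = {}"
  shows "prob (E m) = 0"
proof (rule ccontr)
  assume "prob (E m) \<noteq> 0"
  then have pos: "0 < prob (E m)" by (simp add: zero_less_measure_iff)
  have same: "prob (E (m + 2 * int k)) = prob (E m)" for k
  proof (induction k)
    case (Suc k)
    have "shift -` E (m + 2 * int k) = E (m + 2 * int (Suc k))"
      unfolding equi by (simp add: algebra_simps)
    then show ?case using prob_shift[OF E, of "m + 2 * int k"] Suc by simp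
  qed simp
  obtain n where n: "1 < real n * prob (E m)" using ex_less_of_nat_mult[OF pos] by blast
  have "prob (\<Union>k\<in>{..<n}. E (m + 2 * int k)) = (\<Sum>k<n. prob (E (m + 2 * int k)))"
    by (rule finite_measure_finite_Union) (auto simp: disjoint_family_on_def E intro!: disj)
  also have "\<dots> = real n * prob (E m)" by (simp add: same)
  finally show False using n prob_le_1[of "\<Union>k\<in>{..<n}. E (m + 2 * int k)"] by simp
qed

text \<open>
  Otherwise the set would have a largest or a smallest element, and its position would be a
  distinguished index.
\<close>

lemma stationary_set_unbounded:
  fixes U :: "(int \<Rightarrow> real) \<Rightarrow> int set"
  assumes meas [measurable]: "\<And>i. Measurable.pred N (\<lambda>x. i \<in> U x)"
    and equi: "\<And>i x. i \<in> U (shift x) \<longleftrightarrow> i + 2 \<in> U x"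
  shows "AE x in N. U x = {} \<or> (\<forall>n. (\<exists>i\<in>U x. n \<le> i) \<and> (\<exists>i\<in>U x. i \<le> n))"
proof -
  define E where "E m = {x. m \<in> U x \<and> (\<forall>i. m < i \<longrightarrow> i \<notin> U x)}" for m
  define F where "F m = {x. m \<in> U x \<and> (\<forall>i. i < m \<longrightarrow> i \<notin> U x)}" for m
  have all_shift: "(\<forall>i. Q (i + 2)) \<longleftrightarrow> (\<forall>i::int. Q i)" for Q
    by (metis diff_add_cancel)
  have sets: "E m \<in> sets N" "F m \<in> sets N" for m
  proof -
    have "{x\<in>space N. m \<in> U x \<and> (\<forall>i. m < i \<longrightarrow> i \<notin> U x)} \<in> sets N" by measurable
    then show "E m \<in> sets N" by (simp add: E_def)
    have "{x\<in>space N. m \<in> U x \<and> (\<forall>i. i < m \<longrightarrow> i \<notin> U x)} \<in> sets N" by measurable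
    then show "F m \<in> sets N" by (simp add: F_def)
  qed
  have "prob (E m) = 0" for m
  proof (rule equivariant_disjoint_null[OF sets(1)])
    show "shift -` E m = E (m + 2)" for m
      using all_shift[of "\<lambda>i. m + 2 < i \<longrightarrow> i \<notin> U _"] by (auto simp: E_def equi)
    show "E m \<inter> E n = {}" if "m \<noteq> n" for m n
      using that by (auto simp: E_def) (metis linorder_neqE)
  qed
  moreover have "prob (F m) = 0" for m
  proof (rule equivariant_disjoint_null[OF sets(2)])
    show "shift -` F m = F (m + 2)" for m
      using all_shift[of "\<lambda>i. i < m + 2 \<longrightarrow> i \<notin> U _"] by (auto simp: F_def equi)
    show "F m \<inter> F n = {}" if "m \<noteq> n" for m n
      using that by (auto simp: F_def) (metis linorder_neqE)
  qed
  ultimately have "AE x in N. \<forall>m. x \<notin> E m \<and> x \<notin> F m"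
    unfolding AE_all_countable using sets by (auto intro!: AE_conjI simp: prob_eq_0)
  then show ?thesis
  proof (rule AE_mp, intro AE_I2 impI)
    fix x assume x: "\<forall>m. x \<notin> E m \<and> x \<notin> F m"
    show "U x = {} \<or> (\<forall>n. (\<exists>i\<in>U x. n \<le> i) \<and> (\<exists>i\<in>U x. i \<le> n))"
    proof (rule ccontr)
      assume *: "\<not> (U x = {} \<or> (\<forall>n. (\<exists>i\<in>U x. n \<le> i) \<and> (\<exists>i\<in>U x. i \<le> n)))"
      then obtain k where k: "k \<in> U x" by blast
      obtain n where "(\<forall>i\<in>U x. i < n) \<or> (\<forall>i\<in>U x. n < i)"
        using * by (meson not_le)
        then show False
        proof
          assume n: "\<forall>i\<in>U x. i < n"
          have fin: "finite (U x \<inter> {k..n})" "U x \<inter> {k..n} \<noteq> {}" using k n by force+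
          define m where "m = Max (U x \<inter> {k..n})"
          have "m \<in> U x \<inter> {k..n}" unfolding m_def by (rule Max_in[OF fin])
          moreover have "i \<notin> U x" if "m < i" for i
            using Max_ge[OF fin(1), of i] n that \<open>m \<in> _\<close> unfolding m_def[symmetric] by force
          ultimately show False using x by (auto simp: E_def)
        next
          assume n: "\<forall>i\<in>U x. n < i"
          have fin: "finite (U x \<inter> {n..k})" "U x \<inter> {n..k} \<noteq> {}" using k n by force+
          define m where "m = Min (U x \<inter> {n..k})"
          have "m \<in> U x \<inter> {n..k}" unfolding m_def by (rule Min_in[OF fin])
          moreover have "i \<notin> U x" if "i < m" for i
            using Min_le[OF fin(1), of i] n that \<open>m \<in> _\<close> unfolding m_def[symmetric] by force
          ultimately show False using x by (auto simp: F_def)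
        qed
    qed
  qed
qed

lemma gap_sum_measurable [measurable]: "(\<lambda>x. gap_sum x n) \<in> borel_measurable N"
  unfolding gap_sum_def by measurable

section \<open>Measurability\<close>

text \<open>
  For a fixed list of moves, being legal is a finite combination of comparisons between boundary-points
  and countable quantifiers over indices. There are only countably many lists, so the set of removed
  intervals and all that is defined from it is measurable.
\<close>

lemma legal_measurable [measurable]: "Measurable.pred N (\<lambda>x. legal (gap_sum x) S w)"
proof (induction w arbitrary: S)
  case (Cons I w)
  have [measurable]: "Measurable.pred N (\<lambda>x. removable (gap_sum x) S I)"
    unfolding removable_def by (cases I) simp
  show ?case using Cons by simp
qed simp

lemma removed_measurable [measurable]: "Measurable.pred N (\<lambda>x. I \<in> removed (gap_sum x))"
  unfolding removed_def mem_Collect_eq by measurable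

lemma permanent_measurable [measurable]: "Measurable.pred N (\<lambda>x. k \<in> permanent (gap_sum x))"
  unfolding permanent_def mem_Collect_eq Ball_def by measurable

lemma adjacent_permanent_measurable [measurable]:
  "Measurable.pred N (\<lambda>x. adjacent (permanent (gap_sum x)) a b)"
  unfolding adjacent_def disjoint_iff by measurable

lemma long_gaps_measurable [measurable]: "Measurable.pred N (\<lambda>x. k \<in> long_gaps q (gap_sum x))"
  unfolding long_gaps_def mem_Collect_eq by measurable

lemma covering_measurable [measurable]: "Measurable.pred N (\<lambda>x. I \<in> covering (gap_sum x) m)"
  unfolding in_covering by measurable

lemma covers_everything_measurable [measurable]:
  "Measurable.pred N (\<lambda>x. covers_everything (gap_sum x))"
proof -
  have "covers_everything p \<longleftrightarrow> (\<forall>n. 0 \<le> n \<longrightarrow> (\<exists>I. I \<in> removed p \<and> fst I \<le> - n \<and> n \<le> snd I))" for p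
    by (simp add: covers_everything_def Bex_def case_prod_beta)
  then show ?thesis by simp
qed

text \<open>
  A finite set of intervals is enumerated by a list, so the quantifier over its possible values is a
  countable one.
\<close>

lemma final_colour_measurable [measurable]:
  "Measurable.pred N (\<lambda>x. final_colour c (gap_sum x))"
proof -
  have "final_colour c p \<longleftrightarrow> (\<forall>m. \<exists>l. (\<forall>I. I \<in> covering p m \<longleftrightarrow> I \<in> set l) \<and>
      (even m = even (card (set l)) \<longleftrightarrow> c = Red))" for p
  proof -
    have "finite (covering p m) \<and> (even m = even (card (covering p m)) \<longleftrightarrow> c = Red) \<longleftrightarrow>
      (\<exists>l. covering p m = set l \<and> (even m = even (card (set l)) \<longleftrightarrow> c = Red))" for m
      by (metis List.finite_set finite_list)
    then show ?thesis unfolding final_colour_def set_eq_iff by simp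
  qed
  then show ?thesis by simp
qed

section \<open>Ergodicity of the shift\<close>

text \<open>
  The events that can be approximated in measure by events depending on finitely many coordinates
  form a sigma-algebra.
\<close>

lemma approximation_by_cylinders:
  assumes "A \<in> sets N" "0 < e"
  shows "\<exists>B\<in>generator. prob (sym_diff A B) < e"
proof -
  interpret generator: algebra "space N" generator by (rule algebra_generator)
  have A: "A \<in> sigma_sets (space N) generator"
    using assms(1) by (simp only: sets_PiM_generator)
  have gen: "B \<in> sets N" if "B \<in> generator" for B
    using that unfolding sets_PiM_generator by blast
  show ?thesis
    using A assms(2)
  proof (induction A arbitrary: e rule: sigma_sets.induct)
    case (Basic A)
    then show ?case by (intro bexI[of _ A]) auto
  next
    case Empty
    then show ?case using generator.empty_sets by (intro bexI[of _ "{}"]) simp_all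
  next
    case (Compl A)
    then obtain B where "B \<in> generator" "prob (sym_diff A B) < e" by blast
    moreover have "sym_diff (space N - A) (space N - B) = sym_diff A B" by auto
    ultimately show ?case using generator.compl_sets by metis
  next
    case (Union a)
    have a: "a i \<in> sets N" for i using Union(1) by (simp only: sets_PiM_generator)
    define U where "U n = (\<Union>i<n. a i)" for n :: nat
    have U: "range U \<subseteq> sets N" "incseq U" "(\<Union>n. U n) = (\<Union>i. a i)"
      using a by (auto simp: U_def incseq_def intro: less_le_trans)
    have "(\<lambda>n. prob (U n)) \<longlonglongrightarrow> prob (\<Union>i. a i)"
      using finite_Lim_measure_incseq[OF U(1,2)] U(3) by simp
    then have "\<forall>\<^sub>F n in sequentially. prob (\<Union>i. a i) - e / 2 < prob (U n)"
      using \<open>0 < e\<close> by (intro order_tendstoD) auto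
    then obtain n where n: "prob (\<Union>i. a i) - e / 2 < prob (U n)"
      using eventually_happens'[OF sequentially_bot] by blast
    \<comment> \<open>Half of the error goes to the tail of the union, the rest is shared by its first \<open>n\<close> terms.\<close>
    have "\<exists>B\<in>generator. prob (sym_diff (a i) B) < e / (2 * (real n + 1))" for i
      using Union(2) \<open>0 < e\<close> by simp
    then obtain B where B: "\<And>i. B i \<in> generator"
      "\<And>i. prob (sym_diff (a i) (B i)) < e / (2 * (real n + 1))" by metis
    have BU: "(\<Union>i<n. B i) \<in> generator" using B(1) by (intro generator.finite_UN) auto
    have sd: "sym_diff (a i) (B i) \<in> sets N" for i using a gen B(1) by blast
    have "prob (sym_diff (\<Union>i. a i) (\<Union>i<n. B i))
        \<le> prob (((\<Union>i. a i) - U n) \<union> (\<Union>i<n. sym_diff (a i) (B i)))"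
      using sd U(1) a by (intro P.finite_measure_mono) (auto simp: U_def)
    also have "\<dots> \<le> prob ((\<Union>i. a i) - U n) + prob (\<Union>i<n. sym_diff (a i) (B i))"
      using sd U(1) a by (intro measure_Un_le) auto
    also have "prob ((\<Union>i. a i) - U n) = prob (\<Union>i. a i) - prob (U n)"
      using U a by (intro P.finite_measure_Diff) auto
    also have "prob (\<Union>i<n. sym_diff (a i) (B i)) \<le> (\<Sum>i<n. prob (sym_diff (a i) (B i)))"
      using sd by (intro finite_measure_subadditive_finite) auto
    also have "\<dots> \<le> (\<Sum>i<n. e / (2 * (real n + 1)))"
      using B(2) by (intro sum_mono) (simp add: less_imp_le)
    also have "\<dots> = e / 2 * (real n / (real n + 1))" by simp
    also have "\<dots> \<le> e / 2" using \<open>0 < e\<close> by (intro mult_left_le) auto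
    finally have "prob (sym_diff (\<Union>i. a i) (\<Union>i<n. B i)) < e" using n by simp
    then show ?case using BU by blast
  qed
qed

lemma indep_coordinates: "P.indep_vars P (\<lambda>i x. x i) UNIV"
proof -
  have "distr N N (\<lambda>x. x) = N" by simp
  then show ?thesis
    by (subst P.indep_vars_iff_distr_eq_PiM)
       (simp_all add: restrict_UNIV PiM_component measurable_component_singleton)
qed

lemma iterated_shift: "(shift ^^ n) x = (\<lambda>j. x (j + 2 * int n))"
  by (induction n arbitrary: x) (simp_all add: funpow_swap1 shift_def algebra_simps)

lemma periodic_nat: "P (j + 2 * int n) = P j"
proof (induction n)
  case (Suc n)
  then show ?case using periodic[of "j + 2 * int n"] by (simp add: algebra_simps)
qed simp

lemma iterated_shift_measurable [measurable]: "shift ^^ n \<in> measurable N N"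
  by (induction n) (auto simp: id_def intro: measurable_comp[OF _ shift_measurable] )

lemma prob_iterated_shift: "A \<in> sets N \<Longrightarrow> prob ((shift ^^ n) -` A) = prob A"
proof (induction n arbitrary: A)
  case (Suc n)
  have "shift -` A \<in> sets N"
    using measurable_sets[OF shift_measurable Suc.prems] by simp
  moreover have "(shift ^^ Suc n) -` A = (shift ^^ n) -` (shift -` A)" by auto
  ultimately show ?case using Suc.IH[of "shift -` A"] prob_shift[OF Suc.prems] by (simp only:)
qed simp

text \<open>
  A far enough translate of a finite set of coordinates is disjoint from it.
\<close>

lemma cylinder_independent_of_shift:
  assumes "B \<in> generator"
  shows "\<exists>n. prob (B \<inter> (shift ^^ n) -` B) = prob B * prob B"
proof -
  obtain J X where J: "finite J" and X: "X \<in> sets (PiM J P)" and B: "B = prod_emb UNIV P J X"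
    using assms by (auto elim: generator.cases)
  obtain b where b: "\<forall>j\<in>J. \<bar>j\<bar> \<le> b"
    using J by (metis Max_ge finite_imageI imageI)
  define n where "n = nat \<bar>b\<bar> + 1"
  define J' where "J' = (\<lambda>j. j + 2 * int n) ` J"
  \<comment> \<open>A translation by more than the diameter of \<open>J\<close>.\<close>
  have disj: "J \<inter> J' = {}"
  proof -
    have "j + 2 * int n \<notin> J" if "j \<in> J" for j
    proof
      assume "j + 2 * int n \<in> J"
      then have "\<bar>j + 2 * int n\<bar> \<le> b" "\<bar>j\<bar> \<le> b" using b that by blast+
      moreover have "b < int n" by (simp add: n_def)
      ultimately show False by arith
    qed
    then show ?thesis unfolding J'_def by blast
  qed
  define T where "T y = (\<lambda>j\<in>J. y (j + 2 * int n))" for y :: "int \<Rightarrow> real"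
  have T: "T \<in> measurable (PiM J' P) (PiM J P)"
    unfolding T_def[abs_def]
  proof (rule measurable_restrict)
    fix j assume "j \<in> J"
    then have "(\<lambda>y. y (j + 2 * int n)) \<in> measurable (PiM J' P) (P (j + 2 * int n))"
      by (intro measurable_component_singleton) (simp add: J'_def)
    then show "(\<lambda>y. y (j + 2 * int n)) \<in> measurable (PiM J' P) (P j)"
      by (simp only: periodic_nat)
  qed
  define X' where "X' = T -` X \<inter> space (PiM J' P)"
  have X': "X' \<in> sets (PiM J' P)" unfolding X'_def by (rule measurable_sets[OF T X])
  have B_eq: "B = (\<lambda>x. restrict x J) -` X"
    by (auto simp: B prod_emb_def)
  have B'_eq: "(shift ^^ n) -` B = (\<lambda>x. restrict x J') -` X'"
  proof -
    have "restrict ((shift ^^ n) x) J = T (restrict x J')" for x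
      by (auto simp: T_def iterated_shift J'_def)
    moreover have "restrict x J' \<in> space (PiM J' P)" for x
      by (simp add: space_PiM)
    ultimately show ?thesis by (auto simp: B_eq X'_def)
  qed
  have "P.indep_var (PiM J P) (\<lambda>x. restrict x J) (PiM J' P) (\<lambda>x. restrict x J')"
    using P.indep_var_restrict[OF indep_coordinates disj] by simp
  from P.indep_varD[OF this X X']
  have "prob ((\<lambda>x. restrict x J) -` X \<inter> (\<lambda>x. restrict x J') -` X') =
      prob ((\<lambda>x. restrict x J) -` X) * prob ((\<lambda>x. restrict x J') -` X')"
    by (simp add: vimage_def Int_def)
  then have "prob (B \<inter> (shift ^^ n) -` B) = prob B * prob ((shift ^^ n) -` B)"
    unfolding B_eq[symmetric] B'_eq[symmetric] .
  moreover have "B \<in> sets N" using assms unfolding sets_PiM_generator by blast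
  ultimately show ?thesis using prob_iterated_shift by metis
qed

text \<open>
  If \<open>B\<close> approximates the invariant event \<open>E\<close>, then so does each translate \<open>B'\<close> of \<open>B\<close>, and
  hence \<open>B \<inter> B'\<close>. Choosing \<open>B'\<close> independent of \<open>B\<close> gives \<open>prob E = prob E * prob E\<close>.
\<close>

lemma shift_invariant_zero_one:
  assumes E: "E \<in> sets N" and inv: "shift -` E = E"
  shows "prob E = 0 \<or> prob E = 1"
proof -
  have invn: "(shift ^^ n) -` E = E" for n
  proof (induction n)
    case (Suc n)
    have "(shift ^^ Suc n) -` E = (shift ^^ n) -` (shift -` E)" by auto
    then show ?case using Suc inv by (simp only:)
  qed simp
  have "\<bar>prob E - prob E * prob E\<bar> \<le> 4 * e" if "0 < e" for e
  proof -
    obtain B where B: "B \<in> generator" "prob (sym_diff E B) < e"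
      using approximation_by_cylinders[OF E \<open>0 < e\<close>] by blast
    have Bs: "B \<in> sets N" using B(1) unfolding sets_PiM_generator by blast
    obtain n where n: "prob (B \<inter> (shift ^^ n) -` B) = prob B * prob B"
      using cylinder_independent_of_shift[OF B(1)] by blast
    define B' where "B' = (shift ^^ n) -` B"
    have B's: "B' \<in> sets N"
      using measurable_sets[OF iterated_shift_measurable Bs] by (simp add: B'_def)
    have "sym_diff E B' = (shift ^^ n) -` (sym_diff E B)"
      using invn[of n] unfolding B'_def by blast
    then have eB': "prob (sym_diff E B') < e"
      using prob_iterated_shift[of "sym_diff E B" n] E Bs B(2) by auto
    have 1: "prob E \<le> prob B + prob (sym_diff E B)"
    proof -
      have "prob E \<le> prob (B \<union> sym_diff E B)" using E Bs by (intro P.finite_measure_mono) auto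
      also have "\<dots> \<le> prob B + prob (sym_diff E B)"
        using E Bs by (intro measure_Un_le) auto
      finally show ?thesis .
    qed
    have 2: "prob B \<le> prob E + prob (sym_diff E B)"
    proof -
      have "prob B \<le> prob (E \<union> sym_diff E B)" using E Bs by (intro P.finite_measure_mono) auto
      also have "\<dots> \<le> prob E + prob (sym_diff E B)"
        using E Bs by (intro measure_Un_le) auto
      finally show ?thesis .
    qed
    have 3: "prob E \<le> prob (B \<inter> B') + (prob (sym_diff E B) + prob (sym_diff E B'))"
    proof -
      have "prob E \<le> prob ((B \<inter> B') \<union> (sym_diff E B \<union> sym_diff E B'))"
        using E Bs B's by (intro P.finite_measure_mono) auto
      also have "\<dots> \<le> prob (B \<inter> B') + prob (sym_diff E B \<union> sym_diff E B')"
        using E Bs B's by (intro measure_Un_le) auto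
      also have "prob (sym_diff E B \<union> sym_diff E B') \<le> prob (sym_diff E B) + prob (sym_diff E B')"
        using E Bs B's by (intro measure_Un_le) auto
      finally show ?thesis by simp
    qed
    have 4: "prob (B \<inter> B') \<le> prob E + prob (sym_diff E B)"
    proof -
      have "prob (B \<inter> B') \<le> prob B" using Bs B's by (intro P.finite_measure_mono) auto
      then show ?thesis using 2 by linarith
    qed
    have c: "\<bar>prob E - prob B * prob B\<bar> \<le> 2 * e"
      using 3 4 B(2) eB' n unfolding B'_def[symmetric] by auto
    have "\<bar>prob E * prob E - prob B * prob B\<bar> = \<bar>prob E - prob B\<bar> * \<bar>prob E + prob B\<bar>"
      unfolding abs_mult[symmetric] by (simp add: algebra_simps)
    also have "\<dots> \<le> e * 2"
    proof (rule mult_mono)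
      show "\<bar>prob E - prob B\<bar> \<le> e" using 1 2 B(2) by linarith
      show "\<bar>prob E + prob B\<bar> \<le> 2"
        using prob_le_1[of E] prob_le_1[of B] measure_nonneg[of N E] measure_nonneg[of N B]
        by linarith
    qed (use \<open>0 < e\<close> in simp_all)
    finally show ?thesis using c by linarith
  qed
  then have "\<bar>prob E - prob E * prob E\<bar> \<le> 0 + e" if "0 < e" for e
    using that[THEN half_gt_zero, THEN half_gt_zero] by fastforce
  then have "\<bar>prob E - prob E * prob E\<bar> \<le> 0" by (rule field_le_epsilon)
  then have "prob E * (1 - prob E) = 0" by (simp add: algebra_simps)
  then show ?thesis by auto
qed

lemma shift_invariant_AE:
  assumes [measurable]: "Measurable.pred N Q" and inv: "\<And>x. Q (shift x) \<longleftrightarrow> Q x"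
  shows "(AE x in N. Q x) \<or> (AE x in N. \<not> Q x)"
proof -
  have E: "{x. Q x} \<in> sets N" using predE[OF assms(1)] by simp
  have "shift -` {x. Q x} = {x. Q x}" using inv by auto
  from shift_invariant_zero_one[OF E this] show ?thesis
  proof
    assume "prob {x. Q x} = 0"
    then have "AE x in N. x \<notin> {x. Q x}" using prob_eq_0[OF E] by blast
    then show ?thesis by simp
  next
    assume "prob {x. Q x} = 1"
    then have "AE x in N. x \<in> {x. Q x}" using prob_eq_1[OF E] by blast
    then show ?thesis by simp
  qed
qed

section \<open>Almost sure behaviour\<close>

text \<open>
  Resampling the atomless coordinate \<open>i\<close> alone does not change the law, and \<open>Q\<close> then holds almost
  surely by Fubini's theorem.
\<close>

lemma AE_avoids_one_value:
  assumes atomless: "\<And>y. emeasure (P i) {y} = 0" and [measurable]: "Measurable.pred N Q"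
    and Q: "\<And>x. \<exists>y0. \<forall>y. y \<noteq> y0 \<longrightarrow> Q (x(i := y))"
  shows "AE x in N. Q x"
proof -
  let ?K = "PiM (UNIV - {i}) P" and ?f = "\<lambda>(y, X). X(i := y)"
  have ins: "insert i (UNIV - {i}) = UNIV" by auto
  have N: "distr (P i \<Otimes>\<^sub>M ?K) N ?f = N"
    using distr_pair_PiM_eq_PiM[of "UNIV - {i}" P i] prob_marginal unfolding ins by simp
  have f [measurable]: "?f \<in> measurable (P i \<Otimes>\<^sub>M ?K) N"
  proof -
    have "?f \<in> measurable (P i \<Otimes>\<^sub>M ?K) (PiM (insert i (UNIV - {i})) P)" by measurable
    then show ?thesis by (simp only: ins)
  qed
  interpret K: prob_space ?K by (rule prob_space_PiM) (rule prob_marginal)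
  interpret pair_sigma_finite "P i" ?K ..
  have "{z \<in> space (P i \<Otimes>\<^sub>M ?K). Q (?f z)} \<in> sets (P i \<Otimes>\<^sub>M ?K)"
    by measurable
  then have meas: "{z \<in> space (P i \<Otimes>\<^sub>M ?K). Q ((snd z)(i := fst z))} \<in> sets (P i \<Otimes>\<^sub>M ?K)"
    by (simp add: case_prod_beta)
  have "AE y in P i. Q (?f (y, X))" for X
  proof -
    obtain y0 where y0: "\<forall>y. y \<noteq> y0 \<longrightarrow> Q (X(i := y))" using Q by blast
    have "{y0} \<in> null_sets (P i)" using atomless by (simp add: null_sets_def sets_marginal)
    then have "AE y in P i. y \<notin> {y0}" by (rule AE_not_in)
    then show ?thesis using y0 by (auto elim: eventually_mono)
  qed
  then have "AE X in ?K. AE y in P i. Q (?f (y, X))" by simp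
  then have "AE y in P i. AE X in ?K. Q (?f (y, X))"
    using AE_commute[of "\<lambda>y X. Q (X(i := y))", OF meas] by simp
  then have "AE z in P i \<Otimes>\<^sub>M ?K. Q (?f z)"
    using meas by (intro AE_pair_measure) (simp_all add: case_prod_beta)
  then have "AE x in distr (P i \<Otimes>\<^sub>M ?K) N ?f. Q x"
    using predE[OF assms(2)] by (subst AE_distr_iff[OF f]) simp_all
  then show ?thesis by (simp only: N)
qed

text \<open>
  Two neighbouring intervals contain between them both an even and an odd index, hence a coordinate
  \<open>d\<close> with the atomless law. Given the others, equality of the two lengths determines the value of
  that coordinate.
\<close>

lemma AE_nondegenerate:
  assumes atomless: "\<And>y. emeasure (P i) {y} = 0"
  shows "AE x in N. nondegenerate (gap_sum x)"
proof -
  have one: "AE x in N. gap_sum x k - gap_sum x j \<noteq> gap_sum x l - gap_sum x k"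
    if jkl: "j < k" "k < l" for j k l
  proof -
    obtain d where d: "d \<in> {j + 1..l}" "P d = P i"
    proof -
      \<comment> \<open>As \<open>l \<ge> j + 2\<close>, the range contains an index of the parity of \<open>i\<close>.\<close>
      define d where "d = (if even (j + 1 - i) then j + 1 else j + 2)"
      have "even (d - i)" by (auto simp: d_def)
      then obtain c where c: "d - i = 2 * c" by blast
      have "P d = P i"
      proof (cases "c \<ge> 0")
        case True
        then show ?thesis using periodic_nat[of i "nat c"] c by (simp add: algebra_simps)
      next
        case False
        then show ?thesis using periodic_nat[of d "nat (- c)"] c by (simp add: algebra_simps)
      qed
      moreover have "d \<in> {j + 1..l}" using jkl by (auto simp: d_def)
      ultimately show ?thesis using that by blast
    qed
    show ?thesis
    proof (rule AE_avoids_one_value[of d])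
      show "emeasure (P d) {y} = 0" for y using atomless d by simp
      show "Measurable.pred N (\<lambda>x. gap_sum x k - gap_sum x j \<noteq> gap_sum x l - gap_sum x k)"
        unfolding neq_iff by measurable
      fix x :: "int \<Rightarrow> real"
      have upd: "sum (x(d := y)) A = sum (x(d := 0)) A + (if d \<in> A then y else 0)"
        if "finite A" for y and A :: "int set"
      proof -
        have "sum (x(d := y)) A = (\<Sum>k\<in>A. (x(d := 0)) k + (if k = d then y else 0))"
          by (rule sum.cong) auto
        then show ?thesis using that by (simp add: sum.distrib)
      qed
      let ?a = "sum (x(d := 0)) {j+1..k}" and ?b = "sum (x(d := 0)) {k+1..l}"
      have diffs:
        "gap_sum (x(d := y)) k - gap_sum (x(d := y)) j = ?a + (if d \<in> {j+1..k} then y else 0)"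
        "gap_sum (x(d := y)) l - gap_sum (x(d := y)) k = ?b + (if d \<in> {k+1..l} then y else 0)" for y
        using jkl gap_sum_diff[of j k "x(d := y)"] gap_sum_diff[of k l "x(d := y)"]
          upd[of "{j+1..k}" y] upd[of "{k+1..l}" y] by simp_all
      show "\<exists>y0. \<forall>y. y \<noteq> y0 \<longrightarrow>
        gap_sum (x(d := y)) k - gap_sum (x(d := y)) j \<noteq> gap_sum (x(d := y)) l - gap_sum (x(d := y)) k"
        unfolding diffs using d(1) jkl
        by (intro exI[of _ "if d \<le> k then ?b - ?a else ?a - ?b"]) (simp del: fun_upd_apply; linarith)
    qed
  qed
  have "AE x in N. j < k \<longrightarrow> k < l \<longrightarrow> gap_sum x k - gap_sum x j \<noteq> gap_sum x l - gap_sum x k" for j k l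
    using one[of j k l] by (cases "j < k \<and> k < l") auto
  then show ?thesis unfolding nondegenerate_def AE_all_countable by blast
qed

text \<open>
  Stationarity is used three times. The set of indices of lengths above a small \<open>q\<close> is not empty and
  hence unbounded, so the lengths have infinite sum on both sides. The set of surviving indices, if
  not empty, is unbounded, so each survivor is followed by a gap. The sets of survivors followed by a
  long gap are unbounded if not empty, so every short gap lies between long ones.
\<close>

lemma AE_regular:
  assumes pos: "\<And>j. AE y in P j. 0 < y" and atomless: "\<And>y. emeasure (P i) {y} = 0"
  shows "AE x in N. regular (gap_sum x)"
proof -
  let ?unb = "\<lambda>U. U = {} \<or> (\<forall>n::int. (\<exists>i\<in>U. n \<le> i) \<and> (\<exists>i\<in>U. i \<le> n))"
  have "AE x in N. 0 < x j" for j using AE_component[of j, OF UNIV_I pos] .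
  then have ae_pos: "AE x in N. \<forall>j. 0 < x j" unfolding AE_all_countable by blast
  have "AE x in N. ?unb {i. q < x i}" for q
  proof (rule stationary_set_unbounded)
    show "Measurable.pred N (\<lambda>x. i \<in> {i. q < x i})" for i by simp
  qed (simp add: shift_def)
  then have ae_large: "AE x in N. \<forall>q\<in>\<rat>. ?unb {i. q < x i}"
    by (subst AE_ball_countable) (auto simp: countable_rat)
  have ae_perm: "AE x in N. ?unb (permanent (gap_sum x))"
    by (rule stationary_set_unbounded) (simp_all add: gap_sum_shift permanent_shift)
  have "AE x in N. ?unb (long_gaps q (gap_sum x))" for q
    by (rule stationary_set_unbounded) (simp_all add: gap_sum_shift long_gaps_shift)
  then have ae_long: "AE x in N. \<forall>q\<in>\<rat>. ?unb (long_gaps q (gap_sum x))"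
    by (subst AE_ball_countable) (auto simp: countable_rat)
  show ?thesis
    using ae_pos ae_large ae_perm ae_long AE_nondegenerate[OF atomless]
  proof eventually_elim
    case (elim x)
    let ?p = "gap_sum x"
    have mono: "strict_mono ?p" using elim(1) by (intro strict_mono_gap_sum) simp
    obtain q where q: "q \<in> \<rat>" "0 < q" "q < x 0" using elim(1) Rats_dense_in_real by blast
    then have nonempty: "{i. q < x i} \<noteq> {}" by blast
    have large: "\<forall>n. (\<exists>i\<in>{i. q < x i}. n \<le> i) \<and> (\<exists>i\<in>{i. q < x i}. i \<le> n)"
      using bspec[OF elim(2) q(1)] nonempty by (rule disjE[OF _ notE])
    have "exhausts_line ?p"
    proof (rule exhausts_line_gap_sum[of x q])
      show "0 < x j" for j using elim(1) by blast
      show "\<exists>i\<ge>n. q < x i" "\<exists>i\<le>n. q < x i" for n using large by blast+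
    qed (rule q(2))
    moreover have "permanent ?p = {}"
    proof (rule ccontr)
      assume K: "permanent ?p \<noteq> {}"
      then have "\<exists>k\<in>permanent ?p. n \<le> k" for n using elim(3) by blast
      then obtain r where r: "r \<in> \<rat>" "long_gaps r ?p \<noteq> {}" "short_gaps r ?p \<noteq> {}"
        using exists_long_and_short_gap[OF elim(5) K] by blast
      then obtain v where v: "v \<in> short_gaps r ?p" by blast
      have unb: "\<forall>n. (\<exists>i\<in>long_gaps r ?p. n \<le> i) \<and> (\<exists>i\<in>long_gaps r ?p. i \<le> n)"
        using elim(4) r by blast
      obtain u where "u \<in> long_gaps r ?p" "u \<le> v" using unb by blast
      moreover obtain u' where "u' \<in> long_gaps r ?p" "v \<le> u'" using unb by blast
      ultimately show False
        using no_short_gap_between_long_gaps[OF mono elim(5) _ v] by blast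
    qed
    ultimately show ?case using mono by (simp add: regular_def)
  qed
qed

lemma AE_one_outcome:
  assumes "\<And>j. AE y in P j. 0 < y" and "\<And>y. emeasure (P i) {y} = 0"
  shows "(AE x in N. final_colour Red (gap_sum x)) \<or> (AE x in N. final_colour Blue (gap_sum x)) \<or>
    (AE x in N. covers_everything (gap_sum x))"
proof (rule ccontr)
  assume none: "\<not> ?thesis"
  have "AE x in N. \<not> final_colour c (gap_sum x)" if "\<not> (AE x in N. final_colour c (gap_sum x))" for c
    using shift_invariant_AE[of "\<lambda>x. final_colour c (gap_sum x)"] that
    by (simp add: gap_sum_shift final_colour_shift)
  moreover have "(AE x in N. covers_everything (gap_sum x)) \<or> (AE x in N. \<not> covers_everything (gap_sum x))"
    by (rule shift_invariant_AE) (simp_all add: gap_sum_shift covers_everything_shift)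
  ultimately have "AE x in N. \<not> final_colour Red (gap_sum x)" "AE x in N. \<not> final_colour Blue (gap_sum x)"
      "AE x in N. \<not> covers_everything (gap_sum x)"
    using none by blast+
  then have "AE x in N. False"
    using AE_regular[OF assms]
  proof eventually_elim
    case (elim x)
    then show ?case using trichotomy[of "gap_sum x"] by (auto simp: regular_def)
  qed
  then show False by (simp add: P.AE_False)
qed

end

section \<open>Random colourings\<close>

context recolouring_process begin

lemma final_colour_eventually:
  assumes "exhausts_line p" "final_colour c p"
  shows "eventually_coloured c D s x"
proof -
  obtain m where "p (m - 1) < x" "x \<le> p m" using assms(1) unfolding exhausts_line_def by blast
  then show ?thesis using eventually_coloured_iff assms(2) unfolding final_colour_def by blast
qed

lemma covers_everything_infinitely_often:
  assumes "exhausts_line p" "covers_everything p"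
  shows "infinite (colour_changes D s x)"
proof -
  obtain m where "p (m - 1) < x" "x \<le> p m" using assms(1) unfolding exhausts_line_def by blast
  then show ?thesis using infinite_colour_changes_iff infinite_covering_iff[OF p] assms(2) by blast
qed

end

lemma outcome_independent_of_sequence:
  assumes "recolouring_process p s" "recolouring_process p s'" "exhausts_line p"
  shows "eventually_coloured c (colouring_of p) s x = eventually_coloured c (colouring_of p) s' x"
    and "infinite (colour_changes (colouring_of p) s x) = infinite (colour_changes (colouring_of p) s' x)"
proof -
  interpret a: recolouring_process p s by fact
  interpret b: recolouring_process p s' by fact
  obtain m where "p (m - 1) < x" "x \<le> p m" using assms(3) unfolding exhausts_line_def by blast
  then show "eventually_coloured c (colouring_of p) s x = eventually_coloured c (colouring_of p) s' x"
    and "infinite (colour_changes (colouring_of p) s x) = infinite (colour_changes (colouring_of p) s' x)"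
    by (simp_all only: a.eventually_coloured_iff b.eventually_coloured_iff
        a.infinite_colour_changes_iff b.infinite_colour_changes_iff)
qed

text \<open>
  The merged sequence of lengths has independent coordinates, since it only rearranges the joint
  family of red and blue lengths; its law is the product of the two marginals in alternation.
\<close>

lemma distr_interval_lengths:
  assumes "prob_space M" and indep: "prob_space.indep_vars M (\<lambda>_. borel) (case_sum R B) UNIV"
    and R: "\<And>i. distr M borel (R i) = P\<^sub>R" and B: "\<And>i. distr M borel (B i) = P\<^sub>B"
    and P: "prob_space P\<^sub>R" "prob_space P\<^sub>B" "sets P\<^sub>R = sets borel" "sets P\<^sub>B = sets borel"
  defines "Q \<equiv> \<lambda>j::int. if even j then P\<^sub>R else P\<^sub>B"
    and "Y \<equiv> \<lambda>\<omega>. interval_length (\<lambda>i. R i \<omega>) (\<lambda>i. B i \<omega>)"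
  shows "Y \<in> measurable M (PiM UNIV Q)" and "distr M (PiM UNIV Q) Y = PiM UNIV Q"
proof -
  interpret prob_space M by fact
  define L where "L = case_sum (\<lambda>_::int. P\<^sub>R) (\<lambda>_::int. P\<^sub>B)"
  define f where "f j = (if even j then Inl (j div 2) else Inr (j div 2))" for j :: int
  define X where "X \<omega> = (\<lambda>i. case_sum R B i \<omega>)" for \<omega>
  define g where "g x = (\<lambda>j. x (f j))" for x :: "int + int \<Rightarrow> real"
  have rv: "case_sum R B i \<in> borel_measurable M" for i
    using indep by (simp add: indep_vars_def2)
  have setsL: "sets (L i) = sets borel" for i using P by (cases i) (simp_all add: L_def)
  have probL: "prob_space (L i)" for i using P by (cases i) (simp_all add: L_def)
  have law: "distr M borel (case_sum R B i) = L i" for i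
    using R B by (cases i) (simp_all add: L_def)
  have setsPi: "sets (PiM UNIV (\<lambda>_. borel)) = sets (PiM UNIV L)"
    by (rule sets_PiM_cong) (simp_all add: setsL)
  have "distr M (PiM UNIV (\<lambda>_. borel)) X = PiM UNIV L"
    using indep indep_vars_iff_distr_eq_PiM[where I = UNIV and M' = "\<lambda>_. borel" and X = "case_sum R B"] rv
    by (simp add: restrict_UNIV law X_def[abs_def])
  moreover have "distr M (PiM UNIV L) X = distr M (PiM UNIV (\<lambda>_. borel)) X"
    by (rule distr_cong) (simp_all add: setsPi)
  ultimately have X_law: "distr M (PiM UNIV L) X = PiM UNIV L" by simp
  have "(\<lambda>\<omega>. \<lambda>i\<in>UNIV. case_sum R B i \<omega>) \<in> measurable M (PiM UNIV (\<lambda>_. borel))"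
    using rv by (intro measurable_restrict)
  then have X: "X \<in> measurable M (PiM UNIV L)"
    unfolding measurable_cong_sets[OF refl setsPi] restrict_UNIV X_def[abs_def] .
  have Lf: "L (f j) = Q j" for j by (simp add: L_def f_def Q_def)
  have "(\<lambda>x. \<lambda>j\<in>UNIV. x (f j)) \<in> measurable (PiM UNIV L) (PiM UNIV (\<lambda>j. L (f j)))"
    by (intro measurable_restrict measurable_component_singleton) simp
  then have g: "g \<in> measurable (PiM UNIV L) (PiM UNIV Q)"
    by (simp add: Lf restrict_UNIV g_def[abs_def])
  have "inj f"
    by (rule injI) (auto simp: f_def split: if_splits elim!: evenE oddE)
  then have g_law: "distr (PiM UNIV L) (PiM UNIV Q) g = PiM UNIV Q"
    using distr_PiM_reindex[of UNIV L f UNIV] probL by (simp add: Lf restrict_UNIV g_def[abs_def])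
  have Y: "Y = g \<circ> X"
    by (intro ext) (simp add: Y_def g_def X_def f_def interval_length_def)
  show "Y \<in> measurable M (PiM UNIV Q)" unfolding Y by (rule measurable_comp[OF X g])
  show "distr M (PiM UNIV Q) Y = PiM UNIV Q"
    unfolding Y using distr_distr[OF g X] X_law g_law by simp
qed

theorem proposition2p1:
  fixes M :: "'w measure" and P\<^sub>R P\<^sub>B :: "real measure"
    and R B :: "int \<Rightarrow> 'w \<Rightarrow> real"
  assumes "positive_distribution P\<^sub>R" and "positive_distribution P\<^sub>B"
    and "integrable P\<^sub>R (\<lambda>x. x)" and "integrable P\<^sub>B (\<lambda>x. x)"
    and "non_atomic P\<^sub>R \<or> non_atomic P\<^sub>B"
    and "prob_space M"
    and "prob_space.indep_vars M (\<lambda>_. borel) (case_sum R B) UNIV"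
    and "\<And>i. distr M borel (R i) = P\<^sub>R" and "\<And>i. distr M borel (B i) = P\<^sub>B"
  shows
    "(\<forall>S. (AE \<omega> in M. complete_recolouring (iid_colouring R B \<omega>) (S \<omega>)) \<longrightarrow>
        colour_win Red M (iid_colouring R B) S \<or>
        colour_win Blue M (iid_colouring R B) S \<or>
        tie M (iid_colouring R B) S) \<and>
     (\<forall>S S'. (AE \<omega> in M. complete_recolouring (iid_colouring R B \<omega>) (S \<omega>)) \<longrightarrow>
        (AE \<omega> in M. complete_recolouring (iid_colouring R B \<omega>) (S' \<omega>)) \<longrightarrow>
        (colour_win Red M (iid_colouring R B) S \<longleftrightarrow> colour_win Red M (iid_colouring R B) S') \<and>
        (colour_win Blue M (iid_colouring R B) S \<longleftrightarrow> colour_win Blue M (iid_colouring R B) S') \<and>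
        (tie M (iid_colouring R B) S \<longleftrightarrow> tie M (iid_colouring R B) S'))"
proof -
  define Q where "Q j = (if even j then P\<^sub>R else P\<^sub>B)" for j :: int
  define Y where "Y \<omega> = interval_length (\<lambda>i. R i \<omega>) (\<lambda>i. B i \<omega>)" for \<omega>
  have marginal: "prob_space P\<^sub>R" "prob_space P\<^sub>B" "sets P\<^sub>R = sets borel" "sets P\<^sub>B = sets borel"
    "AE y in P\<^sub>R. 0 < y" "AE y in P\<^sub>B. 0 < y"
    using assms(1,2) by (simp_all add: positive_distribution_def)
  interpret periodic_product Q
    by (rule periodic_product.intro) (simp_all add: Q_def marginal)
  have pos: "AE y in Q j. 0 < y" for j using marginal(5,6) unfolding Q_def by (cases "even j") simp_all
  obtain i where atomless: "emeasure (Q i) {y} = 0" for y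
  proof -
    from assms(5) show ?thesis
    proof
      assume "non_atomic P\<^sub>R"
      then show ?thesis by (intro that[of 0]) (simp add: Q_def non_atomic_def)
    next
      assume "non_atomic P\<^sub>B"
      then show ?thesis by (intro that[of 1]) (simp add: Q_def non_atomic_def)
    qed
  qed
  have Y_meas: "Y \<in> measurable M N" and Y_law: "distr M N Y = N"
    using distr_interval_lengths[OF assms(6-9) marginal(1-4)]
    unfolding Y_def[symmetric] Q_def[symmetric] by simp_all
  have transfer: "AE \<omega> in M. C (Y \<omega>)" if "AE x in N. C x" for C
    using AE_distrD[OF Y_meas, of C] that by (simp only: Y_law)
  define p where "p \<omega> = gap_sum (Y \<omega>)" for \<omega>
  have D: "iid_colouring R B \<omega> = colouring_of (p \<omega>)" for \<omega>
    by (simp add: iid_colouring_def boundary_point_eq_gap_sum p_def Y_def)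
  have reg: "AE \<omega> in M. regular (p \<omega>)"
    unfolding p_def by (rule transfer, rule AE_regular[OF pos atomless])
  have process: "AE \<omega> in M. recolouring_process (p \<omega>) (S \<omega>) \<and> exhausts_line (p \<omega>)"
    if "AE \<omega> in M. complete_recolouring (iid_colouring R B \<omega>) (S \<omega>)" for S
    using that reg by eventually_elim (simp add: D regular_def recolouring_process_def)
  show ?thesis
  proof (intro conjI allI impI)
    fix S assume "AE \<omega> in M. complete_recolouring (iid_colouring R B \<omega>) (S \<omega>)"
    note S = process[OF this]
    have win: "colour_win c M (iid_colouring R B) S" if "AE x in N. final_colour c (gap_sum x)" for c
      unfolding colour_win_def D using S transfer[OF that]
      by eventually_elim (auto simp: p_def intro: recolouring_process.final_colour_eventually)
    have tie: "tie M (iid_colouring R B) S" if "AE x in N. covers_everything (gap_sum x)"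
      unfolding tie_def D using S transfer[OF that]
      by eventually_elim
        (auto simp: p_def dest: recolouring_process.covers_everything_infinitely_often)
    show "colour_win Red M (iid_colouring R B) S \<or> colour_win Blue M (iid_colouring R B) S \<or>
        tie M (iid_colouring R B) S"
      using AE_one_outcome[OF pos atomless] win tie by blast
  next
    fix S S'
    assume "AE \<omega> in M. complete_recolouring (iid_colouring R B \<omega>) (S \<omega>)"
      and "AE \<omega> in M. complete_recolouring (iid_colouring R B \<omega>) (S' \<omega>)"
    note SS' = process[OF this(1)] process[OF this(2)]
    have same: "AE \<omega> in M. \<forall>x.
        (\<forall>c. eventually_coloured c (iid_colouring R B \<omega>) (S \<omega>) x \<longleftrightarrow>
          eventually_coloured c (iid_colouring R B \<omega>) (S' \<omega>) x) \<and>
        (infinite (colour_changes (iid_colouring R B \<omega>) (S \<omega>) x) \<longleftrightarrow>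
          infinite (colour_changes (iid_colouring R B \<omega>) (S' \<omega>) x))"
      unfolding D using SS'
      by eventually_elim (use outcome_independent_of_sequence in blast)
    have win: "colour_win c M (iid_colouring R B) S \<longleftrightarrow> colour_win c M (iid_colouring R B) S'" for c
      unfolding colour_win_def
    proof (rule eventually_subst)
      show "AE \<omega> in M. (\<forall>x. eventually_coloured c (iid_colouring R B \<omega>) (S \<omega>) x) \<longleftrightarrow>
          (\<forall>x. eventually_coloured c (iid_colouring R B \<omega>) (S' \<omega>) x)"
        using same by eventually_elim blast
    qed
    then show "colour_win Red M (iid_colouring R B) S \<longleftrightarrow> colour_win Red M (iid_colouring R B) S'"
      and "colour_win Blue M (iid_colouring R B) S \<longleftrightarrow> colour_win Blue M (iid_colouring R B) S'"
      by blast+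
    show "tie M (iid_colouring R B) S \<longleftrightarrow> tie M (iid_colouring R B) S'"
      unfolding tie_def
    proof (rule eventually_subst)
      show "AE \<omega> in M. (\<forall>x. infinite (colour_changes (iid_colouring R B \<omega>) (S \<omega>) x)) \<longleftrightarrow>
          (\<forall>x. infinite (colour_changes (iid_colouring R B \<omega>) (S' \<omega>) x))"
        using same by eventually_elim blast
    qed
  qed
qed

end
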